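(* There exist constants $0<c<C<\infty$ such that for every integer $n\ge 3$, $$\frac{c}{\log n}\le \inf_{p\in\mathcal{P}_n(\overline{\mathbb{D}})} m(\Lambda_p)\le \frac{C}{\log\log n}.$$
   Context: $\overline{\mathbb{D}}=\{z\in\mathbb{C}: |z|\le 1\}$ is the closed unit disc. $\mathcal{P}_n(\overline{\mathbb{D}})$ is the set of monic complex polynomials of degree $n$ all of whose zeros lie in $\overline{\mathbb{D}}$. For a polynomial $p$, $\Lambda_p=\{z\in\mathbb{C}: |p(z)|<1\}$. $m$ denotes two-dimensional Lebesgue measure on $\mathbb{C}$. *)

theory Defs
  imports "HOL-Analysis.Analysis" "HOL-Computational_Algebra.Polynomial"
begin

definition monic_polys_zeros_in :: "nat \<Rightarrow> complex set \<Rightarrow> complex poly set" where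
  "monic_polys_zeros_in n K =
     {p. degree p = n \<and> lead_coeff p = 1 \<and> (\<forall>z. poly p z = 0 \<longrightarrow> z \<in> K)}"

definition lemniscate :: "complex poly \<Rightarrow> complex set" where
  "lemniscate p = {z. cmod (poly p z) < 1}"

(* For degree p \<ge> 1 the set lemniscate p is open and bounded, so its real-valued
   measure below is its genuine (finite) planar Lebesgue measure. *)

end

theory Submission
  imports Defs "HOL-Complex_Analysis.Complex_Analysis"
    "HOL-Computational_Algebra.Fundamental_Theorem_Algebra"
begin

text \<open>
  Lower bound. For \<open>p z = (\<Prod>j. z - w j)\<close> the polynomial \<open>q z = (\<Prod>j. 1 - cnj (w j) * z)\<close> dominates \<open>p\<close> on
  the unit disc, has no zeros there, and \<open>q 0 = 1\<close>. So it suffices to bound below the area of \<open>Re F < 0\<close>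
  for \<open>F = log q\<close>, \<open>F 0 = 0\<close>; since \<open>q\<close> has degree at most \<open>n\<close>, \<open>log \<bar>F\<bar>\<close> grows by at most \<open>O(n)\<close> between two
  fixed circles. Cut an annulus into \<open>I\<close> (of order \<open>log n\<close>) thin annuli of width of order \<open>1/I\<close>; it is
  enough that half of them contain a disc of radius of order \<open>1/I\<close> in which \<open>Re F < 0\<close> on a fixed proportion
  of the area. If \<open>max (- Re F)\<close> grows at most by a fixed power of \<open>n\<close>, it grows by a bounded factor on half of
  the annuli, and Harnack's inequality at the point of most negative real part gives such a disc. Otherwise
  \<open>log (max \<bar>F\<bar>)\<close>, a convex function of \<open>log r\<close> by Hadamard's theorem, has slopes between a large multiple of
  \<open>log n\<close> and \<open>O(n)\<close>, so on half of the annuli the slope \<open>N\<close> is almost constant. Near a maximum point \<open>a\<close>, \<open>F z\<close>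
  is then \<open>(z / a)^N\<close> times a factor with few zeros, and away from these zeros \<open>F\<close> rotates at rate \<open>N\<close>, so that
  \<open>Re F < 0\<close> in a fixed proportion of the area.

  Upper bound. Pushing the pole of \<open>1 / z\<close> along the real axis and out of the disc gives a
  polynomial \<open>Q\<close> that is at most half as large off a thin strip around the real axis as at \<open>0\<close>. Then
  \<open>A = 1 + \<epsilon> (1 - Q / Q 0)\<close> has modulus more than 1 off the strip, and \<open>p z = A z + z^N A* z\<close>, with \<open>A*\<close> the
  reciprocal polynomial, has all its zeros on the unit circle and is close to \<open>A\<close> inside
  the disc, outside a thin annulus along the circle.
\<close>

section \<open>The Borel--Caratheodory and three circles theorems\<close>

text \<open>The Moebius map \<open>u / (2 * A - u)\<close> takes the half-plane
  \<open>Re u < A\<close> into the unit disc and fixes 0, so the Schwarz lemma applies to its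
  composition with \<open>f\<close>; undoing the map gives the bound on \<open>f\<close>.\<close>

lemma Borel_Caratheodory:
  fixes f :: "complex \<Rightarrow> complex"
  assumes hol: "f holomorphic_on ball a R" and fa: "f a = 0"
    and re: "\<And>z. z \<in> ball a R \<Longrightarrow> Re (f z) < A" and A: "A > 0"
    and z: "z \<in> ball a R"
  shows "cmod (f z) * (R - cmod (z - a)) \<le> 2 * A * cmod (z - a)"
proof -
  have R: "R > 0" using z by (metis ball_eq_empty empty_iff linorder_not_le)
  define g where "g w = f (a + of_real R * w) / (2 * of_real A - f (a + of_real R * w))" for w
  have inb: "a + of_real R * w \<in> ball a R" if "cmod w < 1" for w
    using that R by (simp add: dist_norm norm_mult)
  have nz: "2 * of_real A - f (a + of_real R * w) \<noteq> 0" if "cmod w < 1" for w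
    using re[OF inb[OF that]] A by (auto simp: complex_eq_iff)
  have hol': "(\<lambda>w. f (a + of_real R * w)) holomorphic_on ball 0 1"
    by (rule holomorphic_on_compose_gen[OF _ hol, unfolded o_def])
       (use inb in \<open>auto intro!: holomorphic_intros\<close>)
  have holg: "g holomorphic_on ball 0 1"
    unfolding g_def using nz by (intro holomorphic_intros hol') auto
  have lt1: "cmod (g w) < 1" if w: "cmod w < 1" for w
  proof -
    define u where "u = f (a + of_real R * w)"
    have "Re u < A" unfolding u_def using re[OF inb[OF w]] .
    then have "0 < 4 * A * (A - Re u)" using A by simp
    also have "\<dots> = (cmod (2 * of_real A - u))^2 - (cmod u)^2"
      unfolding cmod_power2 by (simp add: power2_eq_square algebra_simps)
    finally have "(cmod u)^2 < (cmod (2 * of_real A - u))^2" by simp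
    then have "cmod u < cmod (2 * of_real A - u)"
      by (rule power2_less_imp_less) simp
    moreover have "2 * of_real A - u \<noteq> 0" using nz[OF w] unfolding u_def .
    ultimately show ?thesis unfolding g_def u_def[symmetric] by (simp add: norm_divide)
  qed
  define w where "w = (z - a) / of_real R"
  have w1: "cmod w < 1" using z R by (simp add: w_def norm_divide dist_norm norm_minus_commute)
  have aw: "a + of_real R * w = z" using R by (simp add: w_def)
  have g0: "g 0 = 0" by (simp add: g_def fa)
  have gw: "cmod (g w) \<le> cmod w" using Schwarz_Lemma(1)[OF holg g0 lt1 w1] .
  have gz: "g w * (2 * of_real A - f z) = f z"
    using nz[OF w1] unfolding g_def aw by simp
  have "cmod (f z) \<le> cmod w * (2 * A + cmod (f z))"
  proof -
    have "cmod (f z) = cmod (g w) * cmod (2 * of_real A - f z)" by (metis gz norm_mult)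
    also have "\<dots> \<le> cmod w * (2 * A + cmod (f z))"
      using gw A by (intro mult_mono order_trans[OF norm_triangle_ineq4]) (auto simp: norm_mult)
    finally show ?thesis .
  qed
  moreover have wR: "cmod w * R = cmod (z - a)" using R by (simp add: w_def norm_divide)
  ultimately have "cmod (f z) * R \<le> (cmod w * (2 * A + cmod (f z))) * R"
    using R by (intro mult_right_mono) auto
  also have "\<dots> = (cmod w * R) * (2 * A + cmod (f z))" by simp
  finally have "cmod (f z) * R \<le> (cmod w * R) * (2 * A + cmod (f z))" .
  then have "cmod (f z) * R \<le> cmod (z - a) * (2 * A + cmod (f z))" unfolding wR .
  then show ?thesis by (simp add: algebra_simps)
qed

text \<open>Among the maximisers of \<open>|F z| |z|\<^sup>-\<^sup>N\<close> on the closed annulus pick one of least modulus: in the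
  interior, the local maximum principle would produce maximisers of smaller modulus.\<close>

lemma three_circles:
  fixes F :: "complex \<Rightarrow> complex"
  assumes hol: "F holomorphic_on S" and S: "open S" "{z. r1 \<le> cmod z \<and> cmod z \<le> r2} \<subseteq> S"
    and r: "0 < r1"
    and b1: "\<And>z. cmod z = r1 \<Longrightarrow> cmod (F z) \<le> c * r1 powr N"
    and b2: "\<And>z. cmod z = r2 \<Longrightarrow> cmod (F z) \<le> c * r2 powr N"
    and z: "r1 \<le> cmod z" "cmod z \<le> r2"
  shows "cmod (F z) \<le> c * cmod z powr N"
proof -
  define A where "A = {z::complex. r1 \<le> cmod z \<and> cmod z \<le> r2}"
  \<comment> \<open>A power with real exponent \<open>-N\<close> need not have a single-valued
    branch on the annulus, but its modulus is defined globally.\<close>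
  define \<psi> where "\<psi> z = cmod (F z) * cmod z powr (-N)" for z
  have Anz: "w \<noteq> 0" if "w \<in> A" for w using that r by (auto simp: A_def)
  have cA: "compact A"
  proof -
    have "A = cball 0 r2 - ball 0 r1" by (auto simp: A_def)
    then show ?thesis by (simp add: compact_diff)
  qed
  have contF: "continuous_on A F"
    using holomorphic_on_imp_continuous_on[OF hol] S(2) continuous_on_subset A_def by blast
  have cont: "continuous_on A \<psi>"
    unfolding \<psi>_def using Anz by (intro continuous_intros contF) auto
  have Ane: "A \<noteq> {}" using z by (auto simp: A_def)
  obtain m where m: "m \<in> A" "\<And>w. w \<in> A \<Longrightarrow> \<psi> w \<le> \<psi> m"
    using continuous_attains_sup[OF cA Ane cont] by blast
  define K where "K = A \<inter> \<psi> -` {\<psi> m}"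
  have cK: "compact K"
  proof -
    have "closed K" unfolding K_def
      by (rule continuous_closed_preimage[OF cont compact_imp_closed[OF cA]]) auto
    then show ?thesis using cA unfolding K_def by (metis compact_Int_closed inf.left_idem)
  qed
  have Kne: "K \<noteq> {}" using m by (auto simp: K_def)
  obtain a where a: "a \<in> K" "\<And>w. w \<in> K \<Longrightarrow> cmod a \<le> cmod w"
    using continuous_attains_inf[OF cK Kne, of cmod] by (auto intro: continuous_intros)
  have aA: "a \<in> A" and am: "\<psi> a = \<psi> m" using a(1) by (auto simp: K_def)
  have anz: "a \<noteq> 0" using Anz[OF aA] .
  have bd: "cmod a = r1 \<or> cmod a = r2"
  proof (rule ccontr)
    assume "\<not> ?thesis"
    then have ain: "r1 < cmod a" "cmod a < r2" using aA by (auto simp: A_def)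
    define d where "d = min (cmod a - r1) (r2 - cmod a)"
    have d: "d > 0" "d < cmod a" using ain r by (auto simp: d_def)
    have ballA: "ball a d \<subseteq> A"
    proof
      fix w assume "w \<in> ball a d"
      then have "cmod (w - a) < d" by (simp add: dist_norm norm_minus_commute)
      then show "w \<in> A" using norm_triangle_ineq3[of w a] unfolding A_def d_def by auto
    qed
    have wa: "0 < Re (w / a)" if "w \<in> ball a d" for w
    proof -
      have "cmod (w/a - 1) < 1"
      proof -
        have "w/a - 1 = (w - a) / a" using anz by (simp add: diff_divide_distrib)
        then have "cmod (w/a - 1) = cmod (w - a) / cmod a" by (simp add: norm_divide)
        also have "\<dots> < 1" using that d anz by (simp add: dist_norm norm_minus_commute)
        finally show ?thesis .
      qed
      then show ?thesis using abs_Re_le_cmod[of "w/a - 1"] by auto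
    qed
    \<comment> \<open>On this disc \<open>w / a\<close> has positive real part, so the principal
      logarithm gives a holomorphic power; \<open>cmod (g w)\<close> is \<open>\<psi> w\<close> up
      to a constant factor.\<close>
    define g where "g w = F w * exp (- of_real N * Ln (w / a))" for w
    have ng: "cmod (g w) = \<psi> w * cmod a powr N" if w: "w \<in> ball a d" for w
    proof -
      have wnz: "w \<noteq> 0" using wa[OF w] by auto
      have "Re (Ln (w/a)) = ln (cmod w) - ln (cmod a)"
        using wnz anz by (simp add: norm_divide ln_div)
      then have "cmod (exp (- of_real N * Ln (w / a))) = cmod w powr (-N) * cmod a powr N"
        using wnz anz by (simp only: norm_exp_eq_Re)
          (simp add: powr_def exp_add[symmetric] right_diff_distrib)
      then show ?thesis by (simp add: g_def \<psi>_def norm_mult)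
    qed
    have holg: "g holomorphic_on ball a d"
    proof -
      have "w / a \<notin> \<real>\<^sub>\<le>\<^sub>0" if "w \<in> ball a d" for w
        using wa[OF that] by (auto simp: complex_nonpos_Reals_iff)
      moreover have "F holomorphic_on ball a d"
        using hol holomorphic_on_subset ballA S(2) A_def by blast
      ultimately show ?thesis unfolding g_def using anz
        by (intro holomorphic_intros) auto
    qed
    have "g constant_on ball a d"
    proof (rule maximum_modulus_principle[OF holg _ _ open_ball order_refl])
      show "a \<in> ball a d" using d by simp
      fix w assume w: "w \<in> ball a d"
      then have "\<psi> w \<le> \<psi> a" using ballA m(2) am by auto
      then show "cmod (g w) \<le> cmod (g a)"
        using ng[OF w] ng[of a] d by (simp add: mult_right_mono)
    qed auto
    then obtain c0 where c0: "\<And>w. w \<in> ball a d \<Longrightarrow> g w = c0" by (auto simp: constant_on_def)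
    \<comment> \<open>\<open>b\<close> lies on the segment from 0 to \<open>a\<close>, at distance
      \<open>d / 2\<close> from \<open>a\<close>; as \<open>g\<close> is constant, it is a maximiser
      of smaller modulus.\<close>
    define b where "b = a * of_real (1 - d / (2 * cmod a))"
    have f1: "1 - d / (2 * cmod a) > 0" using d anz by (simp add: divide_less_eq)
    have "a - b = a * of_real (d / (2 * cmod a))" by (simp add: b_def algebra_simps)
    then have "cmod (a - b) = cmod a * (d / (2 * cmod a))" using d by (simp add: norm_mult norm_divide)
    also have "\<dots> = d / 2" using anz by simp
    finally have bb: "b \<in> ball a d" using d by (simp add: dist_norm)
    have "\<psi> b = \<psi> a"
      using ng[OF bb] ng[of a] c0[OF bb] c0[of a] d anz by simp
    then have "b \<in> K" using am bb ballA by (auto simp: K_def)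
    moreover have "cmod b < cmod a"
    proof -
      have "cmod b = cmod a * (1 - d / (2 * cmod a))"
        unfolding b_def norm_mult norm_of_real using f1 by simp
      also have "\<dots> < cmod a * 1" using anz d by (intro mult_strict_left_mono) (auto simp: field_simps)
      finally show ?thesis by simp
    qed
    ultimately show False using a(2) by force
  qed
  have "\<psi> a \<le> c"
    using bd
  proof
    assume "cmod a = r1"
    then show ?thesis using b1[of a] r
      by (simp add: \<psi>_def powr_minus field_simps)
  next
    assume "cmod a = r2"
    then show ?thesis using b2[of a] anz
      by (auto simp: \<psi>_def powr_minus field_simps)
  qed
  then have "\<psi> z \<le> c" using m(2)[of z] z am by (auto simp: A_def)
  moreover have "cmod z > 0" using z r by linarith
  ultimately show ?thesis by (simp add: \<psi>_def powr_minus field_simps)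
qed

section \<open>Negative area near a point of steady growth\<close>

text \<open>A finite cover by balls of radius \<open>r/2\<close> bounds the size of every separated
  set, since each ball contains at most one of its points. A separated set of largest size covers
  \<open>G\<close>, as an uncovered point could be added.\<close>

lemma maximal_separated_subset:
  fixes G :: "'a::heine_borel set"
  assumes G: "bounded G" and r: "r > 0"
  obtains Y where "finite Y" "Y \<subseteq> G" "\<And>x y. x \<in> Y \<Longrightarrow> y \<in> Y \<Longrightarrow> x \<noteq> y \<Longrightarrow> r \<le> dist x y"
    "G \<subseteq> (\<Union>y\<in>Y. ball y r)"
proof -
  define P where "P Y \<longleftrightarrow> finite Y \<and> Y \<subseteq> G \<and> (\<forall>x\<in>Y. \<forall>y\<in>Y. x \<noteq> y \<longrightarrow> r \<le> dist x y)" for Y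
  have "compact (closure G)" using G by (simp add: compact_closure)
  then have "seq_compact (closure G)" by (simp add: compact_eq_seq_compact_metric)
  then obtain k where k: "finite k" "closure G \<subseteq> (\<Union>x\<in>k. ball x (r/2))"
    using seq_compact_imp_totally_bounded[of "closure G"] r by (metis half_gt_zero)
  have bound: "card Y \<le> card k" if Y: "P Y" for Y
  proof -
    have "\<exists>c\<in>k. dist c y < r/2" if "y \<in> Y" for y
      proof -
      have "y \<in> closure G" using Y that closure_subset[of G] unfolding P_def by blast
      then obtain c where "c \<in> k" "y \<in> ball c (r/2)" using k(2) by blast
      then show ?thesis by (auto intro: bexI[of _ c])
    qed
    then obtain c where c: "\<And>y. y \<in> Y \<Longrightarrow> c y \<in> k \<and> dist (c y) y < r/2" by metis
    have "inj_on c Y"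
    proof (rule inj_onI, rule ccontr)
      fix x y assume xy: "x \<in> Y" "y \<in> Y" "c x = c y" "x \<noteq> y"
      then have "dist x y < r" using c[of x] c[of y] dist_triangle3[of x y "c x"] by simp
      then show False using Y xy unfolding P_def by fastforce
    qed
    then show ?thesis using c k(1) by (intro card_inj_on_le[of c]) auto
  qed
  have "P {}" by (simp add: P_def)
  then obtain Y where Y: "P Y" "\<And>Z. P Z \<Longrightarrow> card Z \<le> card Y"
    using ex_has_greatest_nat[of P "{}" card "Suc (card k)"] bound by (metis less_Suc_eq_le)
  have "G \<subseteq> (\<Union>y\<in>Y. ball y r)"
  proof
    fix x assume x: "x \<in> G"
    show "x \<in> (\<Union>y\<in>Y. ball y r)"
    proof (rule ccontr)
      assume "\<not> ?thesis"
      then have far: "\<forall>y\<in>Y. r \<le> dist y x" by auto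
      then have "x \<notin> Y" using r by auto
      moreover have "P (insert x Y)" using far Y(1) x unfolding P_def by (auto simp: dist_commute)
      ultimately show False using Y(2)[of "insert x Y"] Y(1) unfolding P_def by auto
    qed
  qed
  then show ?thesis using that[of Y] Y(1) unfolding P_def by blast
qed

section \<open>Areas of discs and the integral of the inverse distance\<close>

lemma content_disk: "r \<ge> 0 \<Longrightarrow> measure lborel (ball (a::complex) r) = pi * r^2"
  using content_ball[of r a] by (simp add: unit_ball_vol_2)

lemma emeasure_disk: "r \<ge> 0 \<Longrightarrow> emeasure lborel (ball (a::complex) r) = ennreal (pi * r^2)"
  using emeasure_ball[of r a] by (simp add: unit_ball_vol_2)

text \<open>Dyadic discs replace polar coordinates: the integrand is dominated by a sum of multiples
  of indicators whose \<open>k\<close>-th integral is \<open>2 * pi * s / 2^k\<close>. The constant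
  is twice the exact one.\<close>

lemma nn_integral_inverse_distance:
  fixes \<zeta> :: complex
  assumes s: "s > 0"
  shows "(\<integral>\<^sup>+z. ennreal (1 / cmod (z - \<zeta>)) * indicator (ball \<zeta> s) z \<partial>lborel) \<le> ennreal (4 * pi * s)"
proof -
  have pt: "ennreal (1 / cmod (z - \<zeta>)) * indicator (ball \<zeta> s) z
      \<le> (\<Sum>k. ennreal (2^(k+1) / s) * indicator (ball \<zeta> (s / 2^k)) z)" (is "_ \<le> suminf ?t") for z
  proof (cases "z \<in> ball \<zeta> s \<and> z \<noteq> \<zeta>")
    case True
    have le: "?t j \<le> suminf ?t" for j
      using sum_le_suminf[of ?t "{j}"] by (simp del: sum_indicator_mult sum_mult_indicator power_Suc)
    define t where "t = cmod (z - \<zeta>)"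
    have t: "0 < t" "t < s" using True by (auto simp: t_def dist_norm norm_minus_commute)
    obtain n where "(1/2)^n < t / s" using real_arch_pow_inv[of "t/s" "1/2"] t s by auto
    then have n: "s / 2^n < t" using s t by (simp add: power_divide field_simps)
    define k where "k = (LEAST n. s / 2^n < t)"
    have k: "s / 2^k < t" unfolding k_def using n by (rule LeastI)
    then have "k \<noteq> 0" using t by (intro notI) simp
    then obtain j where j: "k = Suc j" by (meson not0_implies_Suc)
    have "\<not> s / 2^j < t" using not_less_Least[of j "\<lambda>n. s / 2^n < t"] j k_def by auto
    then have tj: "t \<le> s / 2^j" by simp
    show ?thesis
    \<comment> \<open>The discs are open, so a point at distance exactly \<open>s / 2^j\<close> is
      not in the \<open>j\<close>-th one; the previous term covers it, with weight exactly
      \<open>1 / t\<close>.\<close>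
    proof (cases "t = s / 2^j")
      case eq: True
      then have "j \<noteq> 0" using t by (intro notI) simp
      then obtain i where i: "j = Suc i" by (meson not0_implies_Suc)
      have "z \<in> ball \<zeta> (s / 2^i)" using eq s unfolding i t_def
        by (simp add: dist_norm norm_minus_commute field_simps)
      then have "ennreal (1 / t) \<le> ?t i" using eq s t unfolding i
        by (auto intro!: ennreal_leI simp: field_simps)
      also have "\<dots> \<le> suminf ?t" by (rule le)
      finally show ?thesis using True by (simp add: t_def)
    next
      case False
      then have "z \<in> ball \<zeta> (s / 2^j)" using tj unfolding t_def
        by (simp add: dist_norm norm_minus_commute)
      moreover have "1 / t \<le> 2^(j+1) / s" using k t s unfolding j by (simp add: field_simps)
      ultimately have "ennreal (1 / t) \<le> ?t j" by (simp add: ennreal_leI)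
      also have "\<dots> \<le> suminf ?t" by (rule le)
      finally show ?thesis using True by (simp add: t_def)
    qed
  qed auto
  have "(\<integral>\<^sup>+z. ennreal (1 / cmod (z - \<zeta>)) * indicator (ball \<zeta> s) z \<partial>lborel)
      \<le> (\<integral>\<^sup>+z. (\<Sum>k. ennreal (2^(k+1) / s) * indicator (ball \<zeta> (s / 2^k)) z) \<partial>lborel)"
    by (intro nn_integral_mono pt)
  also have "\<dots> = (\<Sum>k. \<integral>\<^sup>+z. ennreal (2^(k+1) / s) * indicator (ball \<zeta> (s / 2^k)) z \<partial>lborel)"
    by (intro nn_integral_suminf borel_measurable_times_ennreal borel_measurable_indicator) auto
  also have "\<dots> = (\<Sum>k. ennreal (2 * pi * s * (1/2)^k))"
  proof (intro suminf_cong)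
    fix k :: nat
    have "(\<integral>\<^sup>+z. ennreal (2^(k+1) / s) * indicator (ball \<zeta> (s / 2^k)) z \<partial>lborel)
        = ennreal (2^(k+1) / s) * ennreal (pi * (s / 2^k)^2)"
      using s by (simp add: nn_integral_cmult_indicator emeasure_disk)
    also have "\<dots> = ennreal (2^(k+1) / s * (pi * (s / 2^k)^2))"
      using s by (intro ennreal_mult[symmetric]) auto
    also have "2^(k+1) / s * (pi * (s / 2^k)^2) = 2 * pi * s * (1/2)^k"
      using s by (simp add: power2_eq_square power_divide field_simps)
    finally show "(\<integral>\<^sup>+z. ennreal (2^(k+1) / s) * indicator (ball \<zeta> (s / 2^k)) z \<partial>lborel)
      = ennreal (2 * pi * s * (1/2)^k)" .
  qed
  also have "\<dots> = ennreal (2 * pi * s * 2)"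
    using s sums_mult[OF geometric_sums[of "1/2::real"], of "2 * pi * s"]
    by (intro suminf_ennreal_eq) auto
  finally show ?thesis by (simp add: mult_ac)
qed

text \<open>A Jensen-type count: each factor \<open>z - \<zeta>\<close> has modulus at least
  \<open>s/2\<close> on the circle of radius \<open>3 * s / 4\<close> about \<open>a\<close>, but at
  most \<open>s/4\<close> at \<open>a\<close> itself. Hence every zero divided out gains a factor 2
  against the bound \<open>K\<close>. This limits the number of zeros, so a longest list exists, and
  its cofactor \<open>h\<close> has no zero left in the small disc.\<close>

lemma zero_factorization:
  fixes g :: "complex \<Rightarrow> complex"
  assumes hol: "g holomorphic_on ball a s" and s: "s > 0" and ga: "g a = 1"
    and bd: "\<And>z. z \<in> ball a s \<Longrightarrow> cmod (g z) \<le> K"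
  obtains zs h where "h holomorphic_on ball a s" "set zs \<subseteq> cball a (s/4)"
    "\<And>z. z \<in> ball a s \<Longrightarrow> g z = (\<Prod>\<zeta>\<leftarrow>zs. z - \<zeta>) * h z"
    "\<And>z. z \<in> cball a (s/4) \<Longrightarrow> h z \<noteq> 0" "2 ^ length zs \<le> K"
    "\<And>z. z \<in> cball a (3 * s / 4) \<Longrightarrow> cmod (h z) \<le> K * cmod (h a)"
proof -
  define P where "P zs h \<longleftrightarrow> h holomorphic_on ball a s \<and> set zs \<subseteq> cball a (s/4) \<and>
     (\<forall>z\<in>ball a s. g z = (\<Prod>\<zeta>\<leftarrow>zs. z - \<zeta>) * h z)" for zs h
  have lower: "cmod (\<Prod>\<zeta>\<leftarrow>zs. z - \<zeta>) \<ge> (s/2)^length zs"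
    if "set zs \<subseteq> cball a (s/4)" "cmod (z - a) = 3 * s / 4" for zs z
    using that(1)
  proof (induction zs)
    case (Cons \<zeta> zs)
    have "cmod (a - \<zeta>) \<le> s/4" using Cons by (simp add: dist_norm)
    then have "s/2 \<le> cmod (z - \<zeta>)" using that(2) norm_triangle_ineq[of "z - \<zeta>" "\<zeta> - a"]
      by (simp add: norm_minus_commute)
    moreover have "(s/2)^length zs \<le> cmod (\<Prod>\<zeta>\<leftarrow>zs. z - \<zeta>)" using Cons by simp
    ultimately have "s/2 * (s/2)^length zs \<le> cmod (z - \<zeta>) * cmod (\<Prod>\<zeta>\<leftarrow>zs. z - \<zeta>)"
      using s by (intro mult_mono) auto
    then show ?case by (simp add: norm_mult)
  qed simp
  have upper: "cmod (\<Prod>\<zeta>\<leftarrow>zs. a - \<zeta>) \<le> (s/4)^length zs"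
    if "set zs \<subseteq> cball a (s/4)" for zs
    using that
  proof (induction zs)
    case (Cons \<zeta> zs)
    then have "cmod (a - \<zeta>) * cmod (\<Prod>\<zeta>\<leftarrow>zs. a - \<zeta>) \<le> s/4 * (s/4)^length zs"
      using s by (intro mult_mono) (auto simp: dist_norm)
    then show ?case by (simp add: norm_mult)
  qed simp
  have ha: "1 \<le> (s/4)^length zs * cmod (h a)" if "P zs h" for zs h
  proof -
    have "1 = cmod (\<Prod>\<zeta>\<leftarrow>zs. a - \<zeta>) * cmod (h a)" using that s ga unfolding P_def
      by (metis centre_in_ball norm_mult norm_one)
    also have "\<dots> \<le> (s/4)^length zs * cmod (h a)"
      using upper that unfolding P_def by (intro mult_right_mono) auto
    finally show ?thesis .
  qed
  have hb: "cmod (h z) * (s/2)^length zs \<le> K" if P: "P zs h" and z: "z \<in> cball a (3 * s / 4)" for zs h z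
  proof -
    have sub: "cball a (3 * s / 4) \<subseteq> ball a s" using s by auto
    have hol': "h holomorphic_on ball a s" using P by (simp add: P_def)
    have "cmod (h z) \<le> K / (s/2)^length zs"
    proof (rule maximum_modulus_frontier[of h "cball a (3 * s / 4)"])
      show "h holomorphic_on interior (cball a (3 * s / 4))"
        by (rule holomorphic_on_subset[OF hol']) (use sub interior_subset in blast)
      show "continuous_on (closure (cball a (3 * s / 4))) h"
        using holomorphic_on_imp_continuous_on[OF hol'] sub by (auto intro: continuous_on_subset)
      fix w assume "w \<in> frontier (cball a (3 * s / 4))"
      then have w: "cmod (w - a) = 3 * s / 4" by (simp add: dist_norm norm_minus_commute)
      then have wb: "w \<in> ball a s" using s by (simp add: dist_norm norm_minus_commute)
      have "cmod (h w) * (s/2)^length zs \<le> cmod (h w) * cmod (\<Prod>\<zeta>\<leftarrow>zs. w - \<zeta>)"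
        using lower[OF _ w] P unfolding P_def by (intro mult_left_mono) auto
      also have "\<dots> = cmod (g w)" using P wb by (simp add: P_def norm_mult mult.commute)
      also have "\<dots> \<le> K" using bd wb .
      finally show "cmod (h w) \<le> K / (s/2)^length zs" using s by (simp add: field_simps)
    qed (use z in auto)
    then show ?thesis using s by (simp add: field_simps)
  qed
  have len: "2 ^ length zs \<le> K" if P: "P zs h" for zs h
  proof -
    have "2 ^ length zs \<le> 2 ^ length zs * ((s/4)^length zs * cmod (h a))" using ha[OF P] by simp
    also have "\<dots> = cmod (h a) * (2 * (s/4))^length zs"
      by (simp only: power_mult_distrib mult_ac)
    also have "\<dots> = cmod (h a) * (s/2)^length zs" by simp
    also have "\<dots> \<le> K" using hb[OF P, of a] s by simp
    finally show ?thesis .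
  qed
  define Q where "Q zs \<longleftrightarrow> (\<exists>h. P zs h)" for zs
  have Q0: "Q []" using hol unfolding Q_def P_def by (auto intro!: exI[of _ g])
  obtain b :: nat where b: "K < 2^b" using real_arch_pow[of 2 K] by auto
  have "length zs \<le> b" if "Q zs" for zs
  proof -
    have "(2::real) ^ length zs < 2 ^ b" using that len b unfolding Q_def by (metis le_less_trans)
    then show ?thesis by simp
  qed
  then obtain zs where zs: "Q zs" "\<And>ys. Q ys \<Longrightarrow> length ys \<le> length zs"
    using ex_has_greatest_nat[of Q "[]" length "Suc b"] Q0 by (metis less_Suc_eq_le)
  then obtain h where h: "P zs h" by (auto simp: Q_def)
  have hol': "h holomorphic_on ball a s" using h by (simp add: P_def)
  have nz: "h z \<noteq> 0" if z: "z \<in> cball a (s/4)" for z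
  proof
    assume h0: "h z = 0"
    \<comment> \<open>A zero of \<open>h\<close> could be divided out, with the derivative filling
      the removable singularity; the list would become longer.\<close>
    define k where "k w = (if w = z then deriv h z else (h w - h z) / (w - z))" for w
    have "k holomorphic_on ball a s"
      unfolding k_def using pole_lemma_open[OF hol' open_ball] .
    moreover have "h w = (w - z) * k w" for w using h0 by (simp add: k_def)
    ultimately have "P (z # zs) k" using h z unfolding P_def by (auto simp: mult_ac)
    then show False using zs(2)[of "z # zs"] by (auto simp: Q_def)
  qed
  show ?thesis
  proof (rule that[OF hol', of zs])
    show "cmod (h z) \<le> K * cmod (h a)" if z: "z \<in> cball a (3 * s / 4)" for z
    proof -
      have K: "K \<ge> 0" using len[OF h] by (meson order_trans zero_le_numeral zero_le_power)
      have "cmod (h z) \<le> cmod (h z) * (((s/4)^length zs * cmod (h a)))"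
        using ha[OF h] by (simp add: mult_le_cancel_left1)
      also have "\<dots> \<le> cmod (h z) * (((s/2)^length zs * cmod (h a)))"
        using s by (intro mult_left_mono mult_right_mono power_mono) auto
      also have "\<dots> \<le> K * cmod (h a)"
        using mult_right_mono[OF hb[OF h z], of "cmod (h a)"] by (simp add: mult.assoc)
      finally show ?thesis .
    qed
  qed (use h nz len in \<open>auto simp: P_def\<close>)
qed

text \<open>Near \<open>\<eta>\<close> the argument of \<open>F\<close> turns at rate
  \<open>N\<close> in the tangential direction, so a tangential shift of order \<open>1/N\<close>
  brings the value close to the negative real axis.\<close>

lemma negative_disk_nearby:
  fixes F :: "complex \<Rightarrow> complex"
  assumes N: "N > 0" and \<eta>: "1/4 \<le> cmod \<eta>" "cmod \<eta> \<le> 33/32" and F0: "F \<eta> \<noteq> 0"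
    and F: "\<And>z. cmod (z - \<eta>) \<le> 8/N \<Longrightarrow> \<exists>E. F z = F \<eta> * exp (of_real N * (z - \<eta>) / \<eta> + E) \<and> cmod E \<le> 1/4"
  obtains z0 where "cmod (z0 - \<eta>) \<le> 7/N" "\<And>z. cmod (z - z0) < 1/(8*N) \<Longrightarrow> Re (F z) < 0"
proof -
  define \<phi> where "\<phi> = Arg (F \<eta>)"
  have \<phi>: "-pi < \<phi>" "\<phi> \<le> pi" using Arg_bounded[of "F \<eta>"] by (auto simp: \<phi>_def)
  \<comment> \<open>The angle still missing to \<open>pi\<close>. It is less than
    \<open>2 * pi\<close>, so the shift is at most \<open>(33/32) * 6.4 / N\<close>, which is below
    \<open>7 / N\<close>.\<close>
  define \<psi> where "\<psi> = pi - \<phi>"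
  define z0 where "z0 = \<eta> + \<i> * \<eta> * of_real (\<psi> / N)"
  have "\<psi> \<ge> 0" using \<phi> by (simp add: \<psi>_def)
  then have "cmod (z0 - \<eta>) = cmod \<eta> * \<psi> / N" using N by (simp add: z0_def norm_mult norm_divide)
  also have "\<dots> \<le> (33/32) * (2 * 3.2) / N"
    using \<phi> N \<eta> pi_approx by (intro divide_right_mono mult_mono) (auto simp: \<psi>_def)
  also have "\<dots> \<le> 7 / N" using N by (intro divide_right_mono) auto
  finally have z0: "cmod (z0 - \<eta>) \<le> 7/N" .
  have "Re (F z) < 0" if z: "cmod (z - z0) < 1/(8*N)" for z
  proof -
    have \<eta>0: "\<eta> \<noteq> 0" using \<eta> by auto
    have "cmod (z - \<eta>) \<le> 7/N + 1/(8*N)" using z0 z norm_triangle_ineq[of "z - z0" "z0 - \<eta>"] by simp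
    also have "\<dots> \<le> 8/N" using N by (simp add: field_simps)
    finally obtain E where E: "F z = F \<eta> * exp (of_real N * (z - \<eta>) / \<eta> + E)" "cmod E \<le> 1/4"
      using F by blast
    \<comment> \<open>\<open>exp w\<close> measures the deviation from a negative real number;
      \<open>cmod w \<le> 1/2 + 1/4 < pi/2\<close> keeps the cosine positive.\<close>
    define w where "w = of_real N * (z - z0) / \<eta> + E"
    have "of_real N * (z - \<eta>) / \<eta> = of_real N * (z - z0) / \<eta> + of_real N * (z0 - \<eta>) / \<eta>"
      by (simp add: add_divide_distrib[symmetric] algebra_simps)
    also have "of_real N * (z0 - \<eta>) / \<eta> = \<i> * of_real \<psi>" using N \<eta>0 by (simp add: z0_def)
    finally have ex: "of_real N * (z - \<eta>) / \<eta> + E = \<i> * of_real \<psi> + w" by (simp add: w_def)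
    have "F \<eta> = of_real (cmod (F \<eta>)) * exp (\<i> * of_real \<phi>)"
      using Arg_eq[OF F0] by (simp add: \<phi>_def)
    then have "F z = of_real (cmod (F \<eta>)) * (exp (\<i> * of_real \<phi>) * exp (\<i> * of_real \<psi>)) * exp w"
      using E(1) unfolding ex exp_add by (metis mult.assoc)
    also have "exp (\<i> * of_real \<phi>) * exp (\<i> * of_real \<psi>) = exp (\<i> * of_real pi)"
      unfolding exp_add[symmetric] by (simp add: \<psi>_def algebra_simps)
    also have "\<dots> = -1" by (simp add: mult.commute)
    finally have Fz: "Re (F z) = - (cmod (F \<eta>) * (exp (Re w) * cos (Im w)))"
      by (simp add: Re_exp)
    have "cmod (of_real N * (z - z0) / \<eta>) = N * cmod (z - z0) / cmod \<eta>"
      using N by (simp add: norm_mult norm_divide)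
    also have "\<dots> \<le> (1/8) / (1/4)"
      using z N \<eta> by (intro frac_le) (auto simp: field_simps)
    finally have "cmod w \<le> 3/4" using E(2) norm_triangle_ineq[of "of_real N * (z - z0) / \<eta>" E]
      by (simp add: w_def)
    then have "\<bar>Im w\<bar> < pi/2" using abs_Im_le_cmod[of w] pi_gt3 by linarith
    then have "cos (Im w) > 0" by (intro cos_gt_zero_pi) auto
    then show ?thesis using Fz F0 by simp
  qed
  then show ?thesis using that z0 by blast
qed

text \<open>The sum bounds the logarithmic derivative of the product over \<open>zs\<close>. Each
  zero contributes at most \<open>4 * pi * s\<close> to its integral, so Markov's inequality bounds
  the area where it exceeds \<open>T\<close>. The zeros are excluded explicitly because
  \<open>1 / 0 = 0\<close> would hide the pole there; they form a null set.\<close>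

lemma few_points_near_zeros:
  fixes a :: complex
  assumes s: "s > 0" and zs: "set zs \<subseteq> cball a (s/4)" and T: "T > 0"
  defines "G \<equiv> {\<eta> \<in> ball a (s/32). \<eta> \<notin> set zs \<and> (\<Sum>\<zeta>\<leftarrow>zs. 1 / cmod (\<eta> - \<zeta>)) \<le> T}"
  shows "G \<in> lmeasurable" "pi * s^2 / 1024 - real (length zs) * (4 * pi * s) / T \<le> measure lebesgue G"
proof -
  define S where "S \<eta> = (\<Sum>\<zeta>\<leftarrow>zs. 1 / cmod (\<eta> - \<zeta>))" for \<eta>
  have Sm [measurable]: "S \<in> borel_measurable borel"
    unfolding S_def by (induction zs) auto
  have S0: "S \<eta> \<ge> 0" for \<eta> unfolding S_def by (intro sum_list_nonneg) auto
  have int: "(\<integral>\<^sup>+\<eta>. ennreal (\<Sum>\<zeta>\<leftarrow>zs. 1 / cmod (\<eta> - \<zeta>)) * indicator (ball a (s/32)) \<eta> \<partial>lborel)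
      \<le> ennreal (real (length zs) * (4 * pi * s))" using zs
  proof (induction zs)
    case (Cons \<zeta> zs)
    have sub: "ball a (s/32) \<subseteq> ball \<zeta> s"
    proof
      fix x assume "x \<in> ball a (s/32)"
      moreover have "dist a \<zeta> \<le> s/4" using Cons by simp
      ultimately show "x \<in> ball \<zeta> s" using s dist_triangle[of \<zeta> x a] by (simp add: dist_commute)
    qed
    have nn: "0 \<le> (\<Sum>\<zeta>\<leftarrow>zs. 1 / cmod (\<eta> - \<zeta>))" for \<eta> by (intro sum_list_nonneg) auto
    have [measurable]: "(\<lambda>\<eta>. \<Sum>\<zeta>\<leftarrow>zs. 1 / cmod (\<eta> - \<zeta>)) \<in> borel_measurable borel"
      by (induction zs) auto
    have "(\<integral>\<^sup>+\<eta>. ennreal (\<Sum>\<zeta>\<leftarrow>\<zeta>#zs. 1 / cmod (\<eta> - \<zeta>)) * indicator (ball a (s/32)) \<eta> \<partial>lborel)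
      \<le> (\<integral>\<^sup>+\<eta>. ennreal (1 / cmod (\<eta> - \<zeta>)) * indicator (ball \<zeta> s) \<eta> +
           ennreal (\<Sum>\<zeta>\<leftarrow>zs. 1 / cmod (\<eta> - \<zeta>)) * indicator (ball a (s/32)) \<eta> \<partial>lborel)"
      using sub nn by (intro nn_integral_mono) (auto simp: indicator_def ennreal_plus[symmetric] simp del: ennreal_plus)
    also have "\<dots> = (\<integral>\<^sup>+\<eta>. ennreal (1 / cmod (\<eta> - \<zeta>)) * indicator (ball \<zeta> s) \<eta> \<partial>lborel) +
        (\<integral>\<^sup>+\<eta>. ennreal (\<Sum>\<zeta>\<leftarrow>zs. 1 / cmod (\<eta> - \<zeta>)) * indicator (ball a (s/32)) \<eta> \<partial>lborel)"
      by (intro nn_integral_add borel_measurable_times_ennreal borel_measurable_indicator) auto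
    also have "\<dots> \<le> ennreal (4 * pi * s) + ennreal (real (length zs) * (4 * pi * s))"
      using Cons by (intro add_mono nn_integral_inverse_distance s) auto
    also have "\<dots> = ennreal (real (length (\<zeta>#zs)) * (4 * pi * s))"
      using s by (subst ennreal_plus[symmetric]) (auto simp: algebra_simps)
    finally show ?case .
  qed simp
  define B where "B = {\<eta> \<in> ball a (s/32). 1 \<le> ennreal (1/T) * ennreal (S \<eta>)}"
  have Bm: "B \<in> sets lborel" unfolding B_def by measurable
  have "emeasure lborel B \<le> ennreal (1/T) * (\<integral>\<^sup>+\<eta>. ennreal (S \<eta>) * indicator (ball a (s/32)) \<eta> \<partial>lborel)"
    unfolding B_def by (rule nn_integral_Markov_inequality) (auto intro!: borel_measurable_times_ennreal borel_measurable_indicator)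
  also have "\<dots> \<le> ennreal (1/T) * ennreal (real (length zs) * (4 * pi * s))"
    using int unfolding S_def by (intro mult_left_mono) auto
  also have "\<dots> = ennreal (real (length zs) * (4 * pi * s) / T)"
    using T s by (subst ennreal_mult[symmetric]) auto
  finally have eB: "emeasure lborel B \<le> ennreal (real (length zs) * (4 * pi * s) / T)" .
  have BL: "B \<in> sets lebesgue" using Bm by simp
  have mB: "measure lebesgue B \<le> real (length zs) * (4 * pi * s) / T"
    using eB s T Bm by (subst measure_completion) (auto simp: measure_def intro!: enn2real_leI)
  have Bf: "B \<in> lmeasurable"
    by (rule fmeasurableI2[OF lmeasurable_ball[of a "s/32"] _ BL]) (auto simp: B_def)
  have Gs: "G \<in> sets lebesgue"
  proof -
    have "G = {\<eta> \<in> ball a (s/32). S \<eta> \<le> T} - set zs" by (auto simp: G_def S_def)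
    moreover have "{\<eta> \<in> ball a (s/32). S \<eta> \<le> T} \<in> sets lborel" by measurable
    moreover have "set zs \<in> sets lborel" by (simp add: finite_imp_closed)
    ultimately show ?thesis by auto
  qed
  show Gf: "G \<in> lmeasurable"
    by (rule fmeasurableI2[OF lmeasurable_ball[of a "s/32"] _ Gs]) (auto simp: G_def)
  have zl: "set zs \<in> lmeasurable" by (simp add: finite_imp_compact lmeasurable_compact)
  have z0: "measure lebesgue (set zs) = 0"
    using negligible_imp_measure0 negligible_finite by blast
  have "ball a (s/32) \<subseteq> (G \<union> B) \<union> set zs"
  proof
    fix \<eta> assume \<eta>: "\<eta> \<in> ball a (s/32)"
    show "\<eta> \<in> (G \<union> B) \<union> set zs"
    proof (cases "S \<eta> \<le> T")
      case True then show ?thesis using \<eta> by (auto simp: G_def S_def)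
    next
      case False
      then have "1 \<le> (1/T) * S \<eta>" using T by (simp add: field_simps)
      then have "ennreal 1 \<le> ennreal ((1/T) * S \<eta>)" by (rule ennreal_leI)
      then have "1 \<le> ennreal (1/T) * ennreal (S \<eta>)" using T S0 by (subst ennreal_mult[symmetric]) auto
      then show ?thesis using \<eta> by (simp add: B_def)
    qed
  qed
  then have "measure lebesgue (ball a (s/32)) \<le> measure lebesgue ((G \<union> B) \<union> set zs)"
    using Gf Bf zl by (intro measure_mono_fmeasurable) auto
  also have "\<dots> \<le> measure lebesgue (G \<union> B) + measure lebesgue (set zs)"
    using Gf Bf zl by (intro measure_Un_le) auto
  also have "\<dots> \<le> measure lebesgue G + measure lebesgue B"
    using Gf Bf z0 by (simp add: measure_Un_le)
  finally have "pi * (s/32)^2 \<le> measure lebesgue G + measure lebesgue B"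
    using s by (simp add: content_disk)
  then show "pi * s^2 / 1024 - real (length zs) * (4 * pi * s) / T \<le> measure lebesgue G"
    using mB by (simp add: power_divide)
qed

text \<open>With \<open>u = (z - \<eta>) / (\<eta> - \<zeta>)\<close>, each factor changes by
  \<open>exp (Ln (1 + u))\<close>, where \<open>cmod (Ln (1 + u)) \<le> 2 * cmod u\<close>; the
  exponents add up.\<close>

lemma prod_list_shift:
  fixes z \<eta> :: complex
  assumes "\<eta> \<notin> set zs" "cmod (z - \<eta>) * (\<Sum>\<zeta>\<leftarrow>zs. 1 / cmod (\<eta> - \<zeta>)) < 1/2"
  shows "\<exists>E. (\<Prod>\<zeta>\<leftarrow>zs. z - \<zeta>) = (\<Prod>\<zeta>\<leftarrow>zs. \<eta> - \<zeta>) * exp E \<and>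
    cmod E \<le> 2 * cmod (z - \<eta>) * (\<Sum>\<zeta>\<leftarrow>zs. 1 / cmod (\<eta> - \<zeta>))"
  using assms
proof (induction zs)
  case Nil
  then show ?case by (auto intro!: exI[of _ 0])
next
  case (Cons \<zeta> zs)
  define u where "u = (z - \<eta>) / (\<eta> - \<zeta>)"
  have nn: "0 \<le> (\<Sum>\<zeta>\<leftarrow>zs. 1 / cmod (\<eta> - \<zeta>))" by (intro sum_list_nonneg) auto
  have split: "cmod (z - \<eta>) * (\<Sum>\<zeta>\<leftarrow>\<zeta>#zs. 1 / cmod (\<eta> - \<zeta>)) =
      cmod u + cmod (z - \<eta>) * (\<Sum>\<zeta>\<leftarrow>zs. 1 / cmod (\<eta> - \<zeta>))"
    by (simp add: u_def norm_divide algebra_simps)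
  moreover have "0 \<le> cmod (z - \<eta>) * (\<Sum>\<zeta>\<leftarrow>zs. 1 / cmod (\<eta> - \<zeta>))" using nn by simp
  ultimately have u: "cmod u < 1/2" and rest: "cmod (z - \<eta>) * (\<Sum>\<zeta>\<leftarrow>zs. 1 / cmod (\<eta> - \<zeta>)) < 1/2"
    using Cons.prems(2) norm_ge_zero[of u] by linarith+
  obtain E where E: "(\<Prod>\<zeta>\<leftarrow>zs. z - \<zeta>) = (\<Prod>\<zeta>\<leftarrow>zs. \<eta> - \<zeta>) * exp E"
    "cmod E \<le> 2 * cmod (z - \<eta>) * (\<Sum>\<zeta>\<leftarrow>zs. 1 / cmod (\<eta> - \<zeta>))"
    using Cons.IH[OF _ rest] Cons.prems(1) by auto
  have "1 + u \<noteq> 0" using norm_triangle_ineq2[of 1 "- u"] u by auto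
  then have "z - \<zeta> = (\<eta> - \<zeta>) * exp (Ln (1 + u))"
    using Cons.prems(1) by (simp add: u_def field_simps)
  then have "(\<Prod>\<zeta>\<leftarrow>\<zeta>#zs. z - \<zeta>) = (\<Prod>\<zeta>\<leftarrow>\<zeta>#zs. \<eta> - \<zeta>) * exp (Ln (1 + u) + E)"
    by (simp add: E(1) exp_add)
  moreover have "cmod (Ln (1 + u) + E) \<le> 2 * cmod (z - \<eta>) * (\<Sum>\<zeta>\<leftarrow>\<zeta>#zs. 1 / cmod (\<eta> - \<zeta>))"
    using norm_triangle_ineq[of "Ln (1 + u)" E] norm_Ln_le[OF u] E(2) split by simp
  ultimately show ?case by blast
qed

text \<open>Dividing \<open>F\<close> by its value at \<open>a\<close> and by the
  \<open>N\<close>-th power of \<open>z / a\<close> leaves \<open>g\<close> with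
  \<open>g a = 1\<close> and modulus at most \<open>exp (N * s / 2^22)\<close>. So \<open>g\<close>
  has few zeros near \<open>a\<close> and a zero-free cofactor with slowly varying logarithm. At
  most points \<open>\<eta>\<close>, \<open>F\<close> then behaves like
  \<open>exp (N * (z - \<eta>) / \<eta>)\<close> at scale \<open>1/N\<close>, and a separated family
  of such points supplies disjoint discs of negative real part.\<close>

lemma negative_area_of_steady_growth:
  fixes F :: "complex \<Rightarrow> complex"
  assumes hol: "F holomorphic_on ball a s" and Fa: "F a \<noteq> 0"
    and a: "1/2 \<le> cmod a" "cmod a \<le> 1" and s: "0 < s" "s \<le> 1/4" and Ns: "N * s \<ge> 2^13"
    and bd: "\<And>z. z \<in> ball a s \<Longrightarrow> cmod (F z) \<le> cmod (F a) * (cmod z / cmod a) powr N * exp (N * s / 2^22)"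
  shows "pi * s^2 / 2^25 \<le> measure lebesgue (ball a s \<inter> {z. Re (F z) < 0})"
proof -
  have N: "N > 0" using Ns s by (metis linorder_not_less mult_nonpos_nonneg less_le_trans less_imp_le zero_less_numeral zero_less_power order.asym)
  have Nbig: "N \<ge> 2^15"
  proof -
    have "2^13 \<le> N * (1/4)" using Ns mult_left_mono[of s "1/4" N] s N by linarith
    then show ?thesis by simp
  qed
  have sN: "8 / N \<le> s / 1024" using Ns N by (simp add: field_simps)
  have a0: "a \<noteq> 0" using a by auto
  define H where "H = N * s"
  have H: "H > 0" using N s by (simp add: H_def)
  have rat: "0 < Re (w / v)" if "v \<noteq> 0" "cmod (w - v) < cmod v" for w v :: complex
  proof -
    have "w / v - 1 = (w - v) / v" using that by (simp add: diff_divide_distrib)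
    then have "cmod (w / v - 1) < 1" using that by (simp add: norm_divide)
    then show ?thesis using abs_Re_le_cmod[of "w / v - 1"] by auto
  qed
  have posa: "0 < Re (z / a)" if "z \<in> ball a s" for z
    using that a s a0 by (intro rat) (auto simp: dist_norm norm_minus_commute)
  define g where "g z = F z / F a * exp (- of_real N * Ln (z / a))" for z
  have Fg: "F z = F a * exp (of_real N * Ln (z / a)) * g z" for z
    using Fa by (simp add: g_def exp_minus field_simps)
  have holg: "g holomorphic_on ball a s"
  proof -
    have "w / a \<notin> \<real>\<^sub>\<le>\<^sub>0" if "w \<in> ball a s" for w
      using posa[OF that] by (auto simp: complex_nonpos_Reals_iff)
    then show ?thesis unfolding g_def using a0 Fa by (intro holomorphic_intros hol) auto
  qed
  have ga: "g a = 1" using a0 Fa by (simp add: g_def)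
  have gb: "cmod (g z) \<le> exp (H / 2^22)" if z: "z \<in> ball a s" for z
  proof -
    have z0: "z \<noteq> 0" using posa[OF z] by auto
    have "cmod (exp (- of_real N * Ln (z / a))) = (cmod z / cmod a) powr (-N)"
      using z0 a0 by (simp add: norm_exp_eq_Re powr_def norm_divide)
    then have "cmod (g z) = cmod (F z) / cmod (F a) * (cmod z / cmod a) powr (-N)"
      by (simp add: g_def norm_mult norm_divide)
    also have "\<dots> \<le> (cmod z / cmod a) powr N * exp (H / 2^22) * (cmod z / cmod a) powr (-N)"
      using bd[OF z] Fa unfolding H_def by (intro mult_right_mono) (auto simp: field_simps)
    also have "\<dots> = exp (H / 2^22)" using z0 a0 by (simp add: powr_minus)
    finally show ?thesis .
  qed
  obtain zs h where holh: "h holomorphic_on ball a s" and zs: "set zs \<subseteq> cball a (s/4)"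
    and gh: "\<And>z. z \<in> ball a s \<Longrightarrow> g z = (\<Prod>\<zeta>\<leftarrow>zs. z - \<zeta>) * h z"
    and hnz: "\<And>z. z \<in> cball a (s/4) \<Longrightarrow> h z \<noteq> 0" and len: "2 ^ length zs \<le> exp (H / 2^22)"
    and hb: "\<And>z. z \<in> cball a (3 * s / 4) \<Longrightarrow> cmod (h z) \<le> exp (H / 2^22) * cmod (h a)"
    by (rule zero_factorization[OF holg s(1) ga gb, rotated -1]) (rule that)
  have len': "real (length zs) \<le> H / 2^21"
  proof -
    have "real (length zs) * ln 2 \<le> H / 2^22"
      proof -
      have "ln (2 ^ length zs) \<le> ln (exp (H / 2^22))" using len by (subst ln_le_cancel_iff) auto
      then show ?thesis by (simp only: ln_exp ln_realpow zero_less_numeral)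
    qed
    moreover have "real (length zs) * (1/2) \<le> real (length zs) * ln 2"
      using ln2_ge_two_thirds by (intro mult_left_mono) auto
    ultimately show ?thesis by simp
  qed
  have hol4: "h holomorphic_on ball a (s/4)" using holh by (rule holomorphic_on_subset) (use s in auto)
  obtain l where l: "l holomorphic_on ball a (s/4)" "\<And>z. z \<in> ball a (s/4) \<Longrightarrow> exp (l z) = h z"
    using holomorphic_logarithm_exists[OF convex_ball open_ball hol4, of a] hnz s by auto
  have Rel: "Re (l z) \<le> H / 2^22 + Re (l a)" if z: "z \<in> ball a (s/4)" for z
  proof -
    have "exp (Re (l z)) = cmod (h z)" using l(2)[OF z] norm_exp_eq_Re by metis
    also have "\<dots> \<le> exp (H / 2^22) * cmod (h a)" using hb z s by auto
    also have "\<dots> = exp (H / 2^22 + Re (l a))" using l(2)[of a, symmetric] s by (simp add: exp_add)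
    finally show ?thesis by simp
  qed
  \<comment> \<open>Borel-Caratheodory is used twice: here about \<open>a\<close>, to keep
    \<open>l \<eta>\<close> near \<open>l a\<close>, and then about \<open>\<eta>\<close>, where the
    distance \<open>8/N\<close> turns a bound of order \<open>H = N * s\<close> into an absolute
    constant.\<close>
  have la: "cmod (l z - l a) \<le> 4 * H / 2^22" if z: "z \<in> ball a (s/8)" for z
  proof -
    define A where "A = 2 * H / 2^22"
    have "cmod (l z - l a) * (s/4 - cmod (z - a)) \<le> 2 * A * cmod (z - a)"
    proof (rule Borel_Caratheodory[of "\<lambda>z. l z - l a"])
      show "(\<lambda>z. l z - l a) holomorphic_on ball a (s/4)" by (intro holomorphic_intros l)
      fix w assume "w \<in> ball a (s/4)"
      then show "Re (l w - l a) < A" using Rel[of w] H by (simp add: A_def)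
    qed (use z s H in \<open>auto simp: A_def\<close>)
    moreover have za: "cmod (z - a) \<le> s/8" using z by (simp add: dist_norm norm_minus_commute)
    moreover have "cmod (l z - l a) * (s/8) \<le> cmod (l z - l a) * (s/4 - cmod (z - a))"
      using za by (intro mult_left_mono) auto
    moreover have "2 * A * cmod (z - a) \<le> 2 * A * (s/8)"
      using za H by (intro mult_left_mono) (auto simp: A_def)
    ultimately have "cmod (l z - l a) * (s/8) \<le> 2 * A * (s/8)" by linarith
    then show ?thesis using s by (simp add: A_def)
  qed
  have lz: "cmod (l z - l \<eta>) \<le> 1/16" if \<eta>: "\<eta> \<in> ball a (s/32)" and z: "cmod (z - \<eta>) \<le> 8/N" for z \<eta>
  proof -
    define A where "A = 6 * H / 2^22"
    have sub: "ball \<eta> (s/16) \<subseteq> ball a (s/8)"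
    proof
      fix w assume "w \<in> ball \<eta> (s/16)"
      then show "w \<in> ball a (s/8)" using \<eta> s dist_triangle[of a w \<eta>] by simp
    qed
    have \<eta>8: "\<eta> \<in> ball a (s/8)" using \<eta> s by simp
    have zb: "cmod (z - \<eta>) \<le> s/1024" using z sN by linarith
    have "cmod (l z - l \<eta>) * (s/16 - cmod (z - \<eta>)) \<le> 2 * A * cmod (z - \<eta>)"
    proof (rule Borel_Caratheodory[of "\<lambda>z. l z - l \<eta>"])
      show "(\<lambda>z. l z - l \<eta>) holomorphic_on ball \<eta> (s/16)"
        using sub s by (intro holomorphic_intros holomorphic_on_subset[OF l(1)]) auto
      fix w assume w: "w \<in> ball \<eta> (s/16)"
      then have "Re (l w) \<le> H / 2^22 + Re (l a)" using sub s by (intro Rel) auto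
      moreover have "Re (l a) - Re (l \<eta>) \<le> 4 * H / 2^22"
        using la[OF \<eta>8] abs_Re_le_cmod[of "l \<eta> - l a"] by auto
      ultimately show "Re (l w - l \<eta>) < A" using H by (simp add: A_def)
    qed (use zb s H in \<open>auto simp: A_def dist_norm norm_minus_commute\<close>)
    moreover have "cmod (l z - l \<eta>) * (s/32) \<le> cmod (l z - l \<eta>) * (s/16 - cmod (z - \<eta>))"
      using zb s by (intro mult_left_mono) auto
    moreover have "2 * A * cmod (z - \<eta>) \<le> 2 * A * (8/N)"
      using z H by (intro mult_left_mono) (auto simp: A_def)
    moreover have "2 * A * (8/N) = 96 / 2^22 * s" using N by (simp add: A_def H_def)
    ultimately have "cmod (l z - l \<eta>) * (s/32) \<le> 96 / 2^22 * s" by linarith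
    then have "cmod (l z - l \<eta>) * (s/32) \<le> (96 / 2^22 * 32) * (s/32)" by simp
    then have "cmod (l z - l \<eta>) \<le> 96 / 2^22 * 32" using s by (subst (asm) mult_le_cancel_right) auto
    then show ?thesis by simp
  qed
  \<comment> \<open>Over a distance \<open>8/N\<close> this threshold lets the product of the zeros
    change by at most \<open>exp E\<close> with \<open>cmod E \<le> 1/16\<close>, while the
    exceptional area is at most \<open>pi * s^2 / 2048\<close>, half of the small disc.\<close>
  define T where "T = N / 256"
  define G where "G = {\<eta> \<in> ball a (s/32). \<eta> \<notin> set zs \<and> (\<Sum>\<zeta>\<leftarrow>zs. 1 / cmod (\<eta> - \<zeta>)) \<le> T}"
  have Gl: "G \<in> lmeasurable" and Gm0: "pi * s^2 / 1024 - real (length zs) * (4 * pi * s) / T \<le> measure lebesgue G"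
    using few_points_near_zeros[OF s(1) zs, of T] N unfolding G_def T_def by auto
  have Gm: "pi * s^2 / 2048 \<le> measure lebesgue G"
  proof -
    have "real (length zs) * (4 * pi * s) / T \<le> (H / 2^21) * (4 * pi * s) / T"
      using len' s N by (intro divide_right_mono mult_right_mono) (auto simp: T_def)
    also have "\<dots> = pi * s^2 / 2048" using N by (simp add: T_def H_def power2_eq_square)
    finally show ?thesis using Gm0 by simp
  qed
  have near: "\<exists>z0. cmod (z0 - \<eta>) \<le> 7/N \<and> (\<forall>z. cmod (z - z0) < 1/(8*N) \<longrightarrow> Re (F z) < 0)" if \<eta>: "\<eta> \<in> G" for \<eta>
  proof -
    have \<eta>b: "\<eta> \<in> ball a (s/32)" and \<eta>z: "\<eta> \<notin> set zs" and \<eta>S: "(\<Sum>\<zeta>\<leftarrow>zs. 1 / cmod (\<eta> - \<zeta>)) \<le> T"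
      using \<eta> by (auto simp: G_def)
    have \<eta>a: "cmod (\<eta> - a) < s/32" using \<eta>b by (simp add: dist_norm norm_minus_commute)
    have \<eta>n: "1/4 \<le> cmod \<eta>" "cmod \<eta> \<le> 33/32"
      using \<eta>a a s norm_triangle_ineq[of "\<eta> - a" a] norm_triangle_ineq[of "a - \<eta>" \<eta>]
      by (auto simp: norm_minus_commute)
    have \<eta>0: "\<eta> \<noteq> 0" using \<eta>n by auto
    have \<eta>s: "\<eta> \<in> ball a s" using \<eta>b s by auto
    have pz: "(\<Prod>\<zeta>\<leftarrow>zs. \<eta> - \<zeta>) \<noteq> 0" using \<eta>z by (induction zs) auto
    have "h \<eta> \<noteq> 0" using \<eta>b s by (intro hnz) auto
    then have F\<eta>: "F \<eta> \<noteq> 0" using Fa pz by (simp add: Fg[of \<eta>] gh[OF \<eta>s])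
    have "\<exists>E. F z = F \<eta> * exp (of_real N * (z - \<eta>) / \<eta> + E) \<and> cmod E \<le> 1/4" if z: "cmod (z - \<eta>) \<le> 8/N" for z
    proof -
      have zb: "cmod (z - \<eta>) \<le> s/1024" using z sN by linarith
      have za: "z \<in> ball a (s/4)"
        using zb \<eta>a s norm_triangle_ineq[of "z - \<eta>" "\<eta> - a"] by (simp add: dist_norm norm_minus_commute)
      then have zs': "z \<in> ball a s" using s by auto
      define S where "S = (\<Sum>\<zeta>\<leftarrow>zs. 1 / cmod (\<eta> - \<zeta>))"
      have S0: "S \<ge> 0" unfolding S_def by (intro sum_list_nonneg) auto
      have "cmod (z - \<eta>) * S \<le> (8/N) * T"
        using z \<eta>S S0 N by (intro mult_mono) (auto simp: S_def)
      also have "\<dots> = 1/32" using N by (simp add: T_def)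
      finally have zS: "cmod (z - \<eta>) * S \<le> 1/32" .
      then obtain E1 where E1: "(\<Prod>\<zeta>\<leftarrow>zs. z - \<zeta>) = (\<Prod>\<zeta>\<leftarrow>zs. \<eta> - \<zeta>) * exp E1"
         "cmod E1 \<le> 2 * cmod (z - \<eta>) * S"
        using prod_list_shift[OF \<eta>z, of z] unfolding S_def by auto
      have E1b: "cmod E1 \<le> 1/16" using E1(2) zS by simp
      define E2 where "E2 = l z - l \<eta>"
      have E2b: "cmod E2 \<le> 1/16" unfolding E2_def by (rule lz[OF \<eta>b z])
      have hz: "h z = h \<eta> * exp E2"
        using l(2)[OF za] l(2)[of \<eta>] \<eta>b s \<open>h \<eta> \<noteq> 0\<close> by (simp add: E2_def exp_diff)
      define u where "u = (z - \<eta>) / \<eta>"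
      have ub: "cmod u \<le> 32 / N"
      proof -
        have "cmod u \<le> (8/N) / (1/4)" unfolding u_def norm_divide
          using z \<eta>n N by (intro frac_le) auto
        then show ?thesis by simp
      qed
      also have "32 / N \<le> 32 / 2^15" using Nbig N by (intro divide_left_mono) auto
      finally have u2: "cmod u \<le> 1/2" by simp
      \<comment> \<open>The error of linearising \<open>N * Ln (1 + u)\<close>: it is quadratic in
        \<open>u\<close>, hence of order \<open>1/N\<close>.\<close>
      define E3 where "E3 = of_real N * (Ln (1 + u) - u)"
      have "cmod (Ln (1 + u) - u) \<le> (cmod u)^2 / (1 - cmod u)"
        using u2 by (intro Ln_approx_linear) auto
      also have "\<dots> \<le> (cmod u)^2 / (1/2)" using u2 by (intro divide_left_mono) auto
      also have "\<dots> \<le> (32/N)^2 / (1/2)" using ub by (intro divide_right_mono power_mono) auto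
      finally have "cmod E3 \<le> N * ((32/N)^2 / (1/2))"
        using N by (simp add: E3_def norm_mult mult_left_mono)
      also have "\<dots> = 2048 / N" using N by (simp add: power2_eq_square)
      also have "\<dots> \<le> 2048 / 2^15" using Nbig N by (intro divide_left_mono) auto
      finally have E3b: "cmod E3 \<le> 1/16" by simp
      have z\<eta>: "z / \<eta> = 1 + u" using \<eta>0 by (simp add: u_def field_simps)
      have z0: "z \<noteq> 0" using posa[OF zs'] by auto
      \<comment> \<open>Both \<open>\<eta> / a\<close> and \<open>z / \<eta>\<close> lie in the
        right half-plane, so their principal logarithms add without a jump.\<close>
      have "Ln (z / a) = Ln (\<eta> / a * (z / \<eta>))" using \<eta>0 by simp
      also have "\<dots> = Ln (\<eta> / a) + Ln (z / \<eta>)"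
      proof (rule Ln_times_simple)
        have "\<bar>Im (Ln (\<eta> / a))\<bar> < pi/2"
          using posa[OF \<eta>s] \<eta>0 a0 Re_Ln_pos_lt[of "\<eta> / a"] by auto
        moreover have "0 < Re (z / \<eta>)" using u2 abs_Re_le_cmod[of u] by (simp add: z\<eta>)
        then have "\<bar>Im (Ln (z / \<eta>))\<bar> < pi/2"
          using z0 \<eta>0 Re_Ln_pos_lt[of "z / \<eta>"] by auto
        ultimately show "- pi < Im (Ln (\<eta> / a)) + Im (Ln (z / \<eta>))" "Im (Ln (\<eta> / a)) + Im (Ln (z / \<eta>)) \<le> pi"
          by linarith+
      qed (use \<eta>0 a0 z0 in auto)
      finally have "of_real N * Ln (z / a) = of_real N * Ln (\<eta> / a) + (of_real N * u + E3)"
        by (simp add: z\<eta> E3_def algebra_simps)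
      then have "F z = F \<eta> * exp (of_real N * u + (E1 + E2 + E3))"
        by (simp add: Fg[of z] Fg[of \<eta>] gh[OF zs'] gh[OF \<eta>s] hz E1(1) exp_add mult_ac)
      moreover have "cmod (E1 + E2 + E3) \<le> 1/4"
        using norm_triangle_ineq[of "E1 + E2" E3] norm_triangle_ineq[of E1 E2] E1b E2b E3b by linarith
      ultimately show ?thesis by (auto simp: u_def)
    qed
    from negative_disk_nearby[where F = F, OF N \<eta>n F\<eta> this] show ?thesis by metis
  qed
  then obtain c where c: "\<And>\<eta>. \<eta> \<in> G \<Longrightarrow> cmod (c \<eta> - \<eta>) \<le> 7/N"
      "\<And>\<eta> z. \<eta> \<in> G \<Longrightarrow> cmod (z - c \<eta>) < 1/(8*N) \<Longrightarrow> Re (F z) < 0" by metis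
  \<comment> \<open>A disc of radius \<open>1/(8*N)\<close> about \<open>c y\<close> lies within
    \<open>8/N\<close> of \<open>y\<close>, so separation \<open>16/N\<close> makes these discs
    disjoint. Passing from the covering discs to them costs the area ratio
    \<open>(16 * 8)^2 = 2^14\<close>.\<close>
  have "bounded G" by (rule bounded_subset[OF bounded_ball[of a "s/32"]]) (auto simp: G_def)
  then obtain Y where Y: "finite Y" "Y \<subseteq> G" "\<And>x y. x \<in> Y \<Longrightarrow> y \<in> Y \<Longrightarrow> x \<noteq> y \<Longrightarrow> 16/N \<le> dist x y"
    "G \<subseteq> (\<Union>y\<in>Y. ball y (16/N))"
    using maximal_separated_subset[of G "16/N"] N by (metis divide_pos_pos zero_less_numeral)
  have "measure lebesgue G \<le> measure lebesgue (\<Union>y\<in>Y. ball y (16/N))"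
    using Y Gl by (intro measure_mono_fmeasurable) auto
  also have "\<dots> \<le> (\<Sum>y\<in>Y. measure lebesgue (ball y (16/N)))"
    by (rule measure_UNION_le) (use Y in auto)
  also have "\<dots> = real (card Y) * (pi * (16/N)^2)" using N by (simp add: content_disk)
  finally have cardY: "pi * s^2 / 2048 \<le> real (card Y) * (pi * (16/N)^2)" using Gm by linarith
  define L where "L = ball a s \<inter> {z. Re (F z) < 0}"
  have "open L"
  proof -
    have "continuous_on (ball a s) (\<lambda>z. Re (F z))"
      using holomorphic_on_imp_continuous_on[OF hol] by (intro continuous_intros)
    then have "open (ball a s \<inter> (\<lambda>z. Re (F z)) -` {..<0})"
      by (intro continuous_open_preimage) auto
    then show ?thesis by (simp add: L_def vimage_def)
  qed
  then have Lm: "L \<in> lmeasurable" by (intro lmeasurable_open bounded_subset[OF bounded_ball[of a s]]) (auto simp: L_def)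
  have N8: "8 / N = 7/N + 8 * (1/(8*N))" using N by (simp add: field_simps)
  have p8: "1/(8*N) > 0" using N by simp
  have disj: "disjoint_family_on (\<lambda>y. ball (c y) (1/(8*N))) Y"
    unfolding disjoint_family_on_def
  proof (intro ballI impI, rule ccontr)
    fix x y assume xy: "x \<in> Y" "y \<in> Y" "x \<noteq> y"
    assume "ball (c x) (1/(8*N)) \<inter> ball (c y) (1/(8*N)) \<noteq> {}"
    then obtain w where "cmod (w - c x) < 1/(8*N)" "cmod (w - c y) < 1/(8*N)"
      by (auto simp: dist_norm norm_minus_commute)
    moreover have "cmod (c x - x) \<le> 7/N" "cmod (c y - y) \<le> 7/N" using c(1) xy Y(2) by auto
    moreover have "dist x y \<le> cmod (c x - x) + cmod (w - c x) + cmod (w - c y) + cmod (c y - y)"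
      using dist_triangle[of x y w] dist_triangle[of x w "c x"] dist_triangle[of w y "c y"]
      by (simp add: dist_norm norm_minus_commute)
    moreover have "16 / N = 2 * (8 / N)" by simp
    ultimately show False using Y(3)[OF xy] N8 p8 by linarith
  qed
  have sub: "(\<Union>y\<in>Y. ball (c y) (1/(8*N))) \<subseteq> L"
  proof (clarify)
    fix y z assume y: "y \<in> Y" and z: "z \<in> ball (c y) (1/(8*N))"
    have yG: "y \<in> G" using y Y by auto
    have z': "cmod (z - c y) < 1/(8*N)" using z by (simp add: dist_norm norm_minus_commute)
    have "cmod (y - a) < s/32" using yG by (auto simp: G_def dist_norm norm_minus_commute)
    moreover have "cmod (z - a) \<le> cmod (z - c y) + cmod (c y - y) + cmod (y - a)"
      using norm_triangle_ineq[of "z - c y" "c y - a"] norm_triangle_ineq[of "c y - y" "y - a"] by simp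
    ultimately have "cmod (z - a) < s" using z' c(1)[OF yG] N8 sN s p8 by linarith
    then show "z \<in> L" using c(2)[OF yG z'] by (simp add: L_def dist_norm norm_minus_commute)
  qed
  have "pi * s^2 / 2^25 = (pi * s^2 / 2048) / 2^14" by simp
  also have "\<dots> \<le> real (card Y) * (pi * (16/N)^2) / 2^14" using cardY by (intro divide_right_mono) auto
  also have "\<dots> = real (card Y) * (pi * (1/(8*N))^2)" by (simp add: power_divide power_mult_distrib)
  also have "\<dots> = (\<Sum>y\<in>Y. measure lebesgue (ball (c y) (1/(8*N))))" using N by (simp add: content_disk)
  also have "\<dots> = measure lebesgue (\<Union>y\<in>Y. ball (c y) (1/(8*N)))"
    using disj Y(1) by (intro measure_finite_Union[symmetric]) (use emeasure_lborel_ball_finite in \<open>auto simp: less_top[symmetric]\<close>)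
  also have "\<dots> \<le> measure lebesgue L"
    using sub Lm Y(1) by (intro measure_mono_fmeasurable) auto
  finally show ?thesis by (simp add: L_def)
qed

section \<open>Radial growth of a function with small negative set\<close>

text \<open>Generic in \<open>u\<close>, to serve both the modulus of \<open>F\<close> and
  \<open>- Re F\<close>.\<close>

definition circle_max :: "(complex \<Rightarrow> real) \<Rightarrow> real \<Rightarrow> real" where
  "circle_max u r = (SUP z\<in>sphere 0 r. u z)"

lemma circle_max_attained:
  assumes "continuous_on (sphere 0 r) u" "r \<ge> 0"
  obtains a where "cmod a = r" "u a = circle_max u r"
proof -
  have "of_real r \<in> sphere (0::complex) r" using assms(2) by simp
  then have "sphere (0::complex) r \<noteq> {}" by blast
  then obtain a where a: "a \<in> sphere 0 r" "\<And>z. z \<in> sphere 0 r \<Longrightarrow> u z \<le> u a"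
    using continuous_attains_sup[of "sphere 0 r" u] assms(1) by auto
  then have "circle_max u r = u a" unfolding circle_max_def by (intro cSup_eq_maximum) auto
  then show ?thesis using that[of a] a by simp
qed

lemma circle_max_upper:
  assumes "continuous_on (sphere 0 r) u" "cmod z = r"
  shows "u z \<le> circle_max u r"
proof -
  have "compact (u ` sphere 0 r)" using assms(1) by (intro compact_continuous_image) auto
  then show ?thesis unfolding circle_max_def using assms(2)
    by (intro cSUP_upper) (auto simp: bounded_imp_bdd_above compact_imp_bounded)
qed

text \<open>By the reverse triangle inequality, discs of radius \<open>s\<close> are disjoint once
  the moduli of their centres differ by \<open>2 * s\<close>; one disc per thin annulus can
  therefore be summed.\<close>

lemma sum_disjoint_annuli:
  fixes a :: "nat \<Rightarrow> complex"
  assumes J: "finite J" and L: "L \<in> lmeasurable"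
    and sep: "\<And>i j. i \<in> J \<Longrightarrow> j \<in> J \<Longrightarrow> i < j \<Longrightarrow> cmod (a i) + 2 * s \<le> cmod (a j)"
    and v: "\<And>i. i \<in> J \<Longrightarrow> v \<le> measure lebesgue (ball (a i) s \<inter> L)"
  shows "real (card J) * v \<le> measure lebesgue L"
proof -
  have "disjoint_family_on (\<lambda>i. ball (a i) s \<inter> L) J"
    unfolding disjoint_family_on_def
  proof (intro ballI impI, rule ccontr)
    fix i j assume ij: "i \<in> J" "j \<in> J" "i \<noteq> j" "ball (a i) s \<inter> L \<inter> (ball (a j) s \<inter> L) \<noteq> {}"
    then obtain w where w: "cmod (w - a i) < s" "cmod (w - a j) < s"
      by (auto simp: dist_norm norm_minus_commute)
    have "\<bar>cmod (a i) - cmod (a j)\<bar> \<le> cmod (a i - a j)" by (rule norm_triangle_ineq3)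
    also have "\<dots> < 2 * s" using w norm_triangle_ineq4[of "w - a j" "w - a i"] by simp
    finally show False using sep[of i j] sep[of j i] ij(1-3) by (cases "i < j") auto
  qed
  moreover have m: "ball (a i) s \<inter> L \<in> lmeasurable" for i using L by (intro fmeasurable_Int_fmeasurable) auto
  ultimately have "measure lebesgue (\<Union>i\<in>J. ball (a i) s \<inter> L) = (\<Sum>i\<in>J. measure lebesgue (ball (a i) s \<inter> L))"
    using J by (intro measure_finite_Union) (use fmeasurableD2[OF m] fmeasurableD[OF m] in auto)
  moreover have "real (card J) * v \<le> (\<Sum>i\<in>J. measure lebesgue (ball (a i) s \<inter> L))"
    using sum_mono[of J "\<lambda>_. v"] v by simp
  moreover have "measure lebesgue (\<Union>i\<in>J. ball (a i) s \<inter> L) \<le> measure lebesgue L"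
    using L m J by (intro measure_mono_fmeasurable) auto
  ultimately show ?thesis by linarith
qed

section \<open>Maxima of the modulus and of minus the real part on circles\<close>

context
  fixes F :: "complex \<Rightarrow> complex"
  assumes hol: "F holomorphic_on ball 0 1" and F0: "F 0 = 0"
begin

abbreviation "max_mod \<equiv> circle_max (\<lambda>z. cmod (F z))"
abbreviation "max_neg \<equiv> circle_max (\<lambda>z. - Re (F z))"
abbreviation "neg_set \<equiv> ball 0 1 \<inter> {z. Re (F z) < 0}"

lemma cont_cball: "r < 1 \<Longrightarrow> continuous_on (cball 0 r) F"
  by (rule continuous_on_subset[OF holomorphic_on_imp_continuous_on[OF hol]]) auto

lemma cont_sphere: "r < 1 \<Longrightarrow> continuous_on (sphere 0 r) F"
  by (rule continuous_on_subset[OF cont_cball[of r]]) auto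

lemma cont_max_mod: "r < 1 \<Longrightarrow> continuous_on (sphere 0 r) (\<lambda>z. cmod (F z))"
  and cont_max_neg: "r < 1 \<Longrightarrow> continuous_on (sphere 0 r) (\<lambda>z. - Re (F z))"
  by (intro continuous_intros cont_sphere; simp)+

lemma max_mod_attained: "0 \<le> r \<Longrightarrow> r < 1 \<Longrightarrow> \<exists>a. cmod a = r \<and> cmod (F a) = max_mod r"
  and max_neg_attained: "0 \<le> r \<Longrightarrow> r < 1 \<Longrightarrow> \<exists>a. cmod a = r \<and> - Re (F a) = max_neg r"
  using circle_max_attained[OF cont_max_mod, of r] circle_max_attained[OF cont_max_neg, of r] by metis+

lemma negative_set_lmeasurable: "neg_set \<in> lmeasurable"
proof -
  have "open (ball 0 1 \<inter> (\<lambda>z. Re (F z)) -` {..<0})"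
    using holomorphic_on_imp_continuous_on[OF hol]
    by (intro continuous_open_preimage continuous_intros) auto
  then have "open neg_set" by (simp add: vimage_def)
  then show ?thesis by (intro lmeasurable_open bounded_subset[OF bounded_ball[of 0 1]]) auto
qed

lemma max_mod_upper: "cmod z \<le> r \<Longrightarrow> r < 1 \<Longrightarrow> cmod (F z) \<le> max_mod r"
proof (rule maximum_modulus_frontier[of F "cball 0 r"])
  assume r: "cmod z \<le> r" "r < 1"
  show "F holomorphic_on interior (cball 0 r)"
    using r by (intro holomorphic_on_subset[OF hol]) (auto simp: interior_cball)
  show "continuous_on (closure (cball 0 r)) F" using cont_cball[OF r(2)] by simp
  show "cmod (F w) \<le> max_mod r" if "w \<in> frontier (cball 0 r)" for w
    using that r cont_max_mod by (intro circle_max_upper) (auto simp: dist_norm)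
qed auto

lemma max_neg_upper: "cmod z \<le> r \<Longrightarrow> r < 1 \<Longrightarrow> - Re (F z) \<le> max_neg r"
proof -
  assume r: "cmod z \<le> r" "r < 1"
  have "Re ((\<lambda>z. - F z) z) \<le> max_neg r"
  proof (rule maximum_real_frontier[of "\<lambda>z. - F z" "cball 0 r"])
    show "(\<lambda>z. - F z) holomorphic_on interior (cball 0 r)"
      using r by (intro holomorphic_intros holomorphic_on_subset[OF hol]) (auto simp: interior_cball)
    show "continuous_on (closure (cball 0 r)) (\<lambda>z. - F z)"
      using cont_cball[OF r(2)] by (auto intro: continuous_intros)
    show "Re (- F w) \<le> max_neg r" if "w \<in> frontier (cball 0 r)" for w
      using that r cont_max_neg[of r] circle_max_upper[of r "\<lambda>z. - Re (F z)" w] by (simp add: dist_norm)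
  qed (use r in auto)
  then show ?thesis by simp
qed

lemma max_neg_nonneg: "0 \<le> r \<Longrightarrow> r < 1 \<Longrightarrow> 0 \<le> max_neg r"
  using max_neg_upper[of 0 r] F0 by simp

text \<open>This is \<open>Borel_Caratheodory\<close> for \<open>- F\<close>. That lemma wants a
  strict and positive bound, so the maximum is raised by \<open>e / 2\<close> and \<open>e\<close>
  tends to 0.\<close>

lemma max_neg_controls_modulus:
  assumes "cmod z < r" "r < 1"
  shows "cmod (F z) * (r - cmod z) \<le> 2 * max_neg r * cmod z"
proof (rule field_le_epsilon)
  fix e :: real assume e: "e > 0"
  have r: "r > 0" using assms by (meson norm_ge_zero order_le_less_trans)
  define A where "A = max_neg r + e / 2"
  have "cmod (- F z) * (r - cmod (z - 0)) \<le> 2 * A * cmod (z - 0)"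
  proof (rule Borel_Caratheodory[of "\<lambda>z. - F z"])
    show "(\<lambda>z. - F z) holomorphic_on ball 0 r"
      using assms by (intro holomorphic_intros holomorphic_on_subset[OF hol]) auto
    show "Re (- F w) < A" if "w \<in> ball 0 r" for w
      using max_neg_upper[of w r] that assms e by (simp add: A_def)
    show "A > 0" using max_neg_nonneg[of r] r assms e by (simp add: A_def)
  qed (use assms F0 in auto)
  also have "2 * A * cmod (z - 0) \<le> 2 * max_neg r * cmod z + e * 1"
    using assms e by (simp add: A_def algebra_simps)
  finally show "cmod (F z) * (r - cmod z) \<le> 2 * max_neg r * cmod z + e" by simp
qed

text \<open>The \<open>I\<close> increments of \<open>ln (max_neg (r i))\<close> are nonnegative
  with sum at most \<open>K * I\<close>, so at least half are at most \<open>2 * K\<close>. On such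
  a step Borel-Caratheodory about a point of most negative real part keeps \<open>Re F\<close>
  negative on a disc of radius \<open>\<tau> * s\<close>.\<close>

lemma slow_growth_case:
  assumes K: "K \<ge> 0" and I: "I > 0" and m0: "max_neg (1/2) > 0"
    and slow: "max_neg (5/8) \<le> exp (K * real I) * max_neg (1/2)"
  shows "pi / (2048 * exp (4 * K) * real I) \<le> measure lebesgue neg_set"
proof -
  define s where "s = 1 / (8 * real I)"
  have s: "s > 0" using I by (simp add: s_def)
  define r where "r i = 1/2 + real i * s" for i :: nat
  have r0: "r 0 = 1/2" and rI: "r I = 5/8" using I by (auto simp: r_def s_def)
  have rr: "1/2 \<le> r i" "r i \<le> 5/8" if "i \<le> I" for i
  proof -
    show "1/2 \<le> r i" using s by (simp add: r_def)
    have "r i \<le> r I" unfolding r_def using that s by (intro add_mono mult_right_mono) auto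
    then show "r i \<le> 5/8" using rI by simp
  qed
  have mono: "max_neg (r i) \<le> max_neg (r j)" if "i \<le> j" "j \<le> I" for i j
  proof -
    have rij: "r i \<le> r j" unfolding r_def using that s by (intro add_mono mult_right_mono) auto
    have "0 \<le> r i" "r i < 1" using rr[of i] that by auto
    then obtain a where "cmod a = r i" "- Re (F a) = max_neg (r i)" using max_neg_attained by blast
    then show ?thesis using max_neg_upper[of a "r j"] rij rr[of j] that by auto
  qed
  have mpos: "max_neg (r i) > 0" if "i \<le> I" for i using mono[of 0 i] that m0 r0 by simp
  define d where "d i = ln (max_neg (r (Suc i))) - ln (max_neg (r i))" for i
  have d0: "d i \<ge> 0" if "i < I" for i
    using mono[of i "Suc i"] mpos[of i] that by (simp add: d_def)
  have "(\<Sum>i<I. d i) = ln (max_neg (r I)) - ln (max_neg (r 0))" unfolding d_def by (rule sum_lessThan_telescope)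
  also have "\<dots> \<le> K * real I"
  proof -
    have "ln (max_neg (5/8)) \<le> ln (exp (K * real I) * max_neg (1/2))"
      using slow mpos[of I] rI by (subst ln_le_cancel_iff) (use m0 in auto)
    then show ?thesis using m0 by (simp add: ln_mult r0 rI)
  qed
  finally have dsum: "(\<Sum>i<I. d i) \<le> K * real I" .
  define J where "J = {i\<in>{..<I}. d i \<le> 2 * K}"
  have cardJ: "real I \<le> 2 * real (card J)"
  \<comment> \<open>The counting argument cancels a factor \<open>K\<close>, so vanishing
    \<open>K\<close> is treated apart.\<close>
  proof (cases "K = 0")
    case True
    then have "(\<Sum>i<I. d i) = 0" using dsum d0 by (intro antisym sum_nonneg) auto
    then have "\<And>i. i < I \<Longrightarrow> d i = 0" using d0 by (subst (asm) sum_nonneg_eq_0_iff) auto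
    then have "J = {..<I}" using True by (auto simp: J_def)
    then show ?thesis by simp
  next
    case False
    define B where "B = {..<I} - J"
    have "J \<subseteq> {..<I}" "finite J" by (auto simp: J_def)
    then have "card B = I - card J" "card J \<le> I"
      using card_Diff_subset[of J "{..<I}"] card_mono[of "{..<I}" J] by (auto simp: B_def)
    then have cB: "card B + card J = I" by simp
    have "2 * K * real (card B) = (\<Sum>i\<in>B. 2 * K)" by simp
    also have "\<dots> \<le> (\<Sum>i\<in>B. d i)" by (intro sum_mono) (auto simp: B_def J_def)
    also have "\<dots> \<le> (\<Sum>i<I. d i)" using d0 by (intro sum_mono2) (auto simp: B_def)
    finally have "2 * K * real (card B) \<le> K * real I" using dsum by linarith
    then have "K * (2 * real (card B)) \<le> K * real I" by simp
    then have "2 * real (card B) \<le> real I" using K False by (subst (asm) mult_le_cancel_left) auto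
    then show ?thesis using cB by linarith
  qed
  \<comment> \<open>Chosen so that the variation \<open>D\<close> of \<open>F\<close> satisfies
    \<open>D * (3/4) \<le> max_neg (r i) / 2\<close>, leaving \<open>D\<close> below the depth of
    the negative value at the centre.\<close>
  define \<tau> where "\<tau> = 1 / (4 * exp (2 * K))"
  have \<tau>: "0 < \<tau>" "\<tau> \<le> 1/4" using K by (auto simp: \<tau>_def field_simps)
  have "\<exists>a. cmod a = r i \<and> ball a (\<tau> * s) \<subseteq> neg_set" if i: "i \<in> J" for i
  proof -
    have iI: "Suc i \<le> I" "i < I" and di: "d i \<le> 2 * K" using i by (auto simp: J_def)
    have mr: "max_neg (r (Suc i)) \<le> exp (2 * K) * max_neg (r i)"
    proof -
      have "ln (max_neg (r (Suc i))) \<le> ln (exp (2 * K) * max_neg (r i))"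
        using di mpos[of i] iI by (simp add: d_def ln_mult)
      then show ?thesis using mpos[of i] mpos[of "Suc i"] iI by (subst (asm) ln_le_cancel_iff) auto
    qed
    obtain a where a: "cmod a = r i" "- Re (F a) = max_neg (r i)"
      using max_neg_attained[of "r i"] rr[of i] iI by auto
    have rS: "r (Suc i) = r i + s" by (simp add: r_def algebra_simps)
    have sub: "cmod z \<le> r (Suc i)" if "z \<in> ball a s" for z
      using that a(1) rS norm_triangle_ineq[of "z - a" a] by (simp add: dist_norm norm_minus_commute)
    have r1: "r (Suc i) < 1" using rr[of "Suc i"] iI by simp
    have "z \<in> neg_set" if z: "z \<in> ball a (\<tau> * s)" for z
    proof -
      have za: "cmod (z - a) < \<tau> * s" using z by (simp add: dist_norm norm_minus_commute)
      also have ts: "\<tau> * s \<le> 1/4 * s" using \<tau> s by (intro mult_right_mono) auto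
      finally have zs: "z \<in> ball a s" using s by (simp add: dist_norm norm_minus_commute)
      define D where "D = cmod (- (F z - F a))"
      have "D * (s - cmod (z - a)) \<le> 2 * max_neg (r (Suc i)) * cmod (z - a)"
        unfolding D_def
      proof (rule Borel_Caratheodory[of "\<lambda>z. - (F z - F a)"])
        have "ball a s \<subseteq> ball 0 1" using sub r1 by fastforce
        then show "(\<lambda>z. - (F z - F a)) holomorphic_on ball a s"
          by (intro holomorphic_intros holomorphic_on_subset[OF hol])
        show "Re (- (F w - F a)) < max_neg (r (Suc i))" if "w \<in> ball a s" for w
          using max_neg_upper[OF sub[OF that] r1] a(2) mpos[of i] iI by simp
      qed (use zs mpos[of "Suc i"] iI in auto)
      also have "\<dots> \<le> 2 * max_neg (r (Suc i)) * (\<tau> * s)"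
        using za mpos[of "Suc i"] iI by (intro mult_left_mono) auto
      finally have "D * (s - cmod (z - a)) \<le> 2 * max_neg (r (Suc i)) * (\<tau> * s)" .
      moreover have "D * (3/4 * s) \<le> D * (s - cmod (z - a))"
        using za ts by (intro mult_left_mono) (auto simp: D_def)
      ultimately have "D * (3/4 * s) \<le> 2 * max_neg (r (Suc i)) * (\<tau> * s)" by linarith
      then have "(D * (3/4)) * s \<le> (2 * max_neg (r (Suc i)) * \<tau>) * s" by (simp add: mult_ac)
      then have "D * (3/4) \<le> 2 * max_neg (r (Suc i)) * \<tau>" using s by (subst (asm) mult_le_cancel_right) auto
      also have "\<dots> \<le> 2 * (exp (2 * K) * max_neg (r i)) * \<tau>"
        using mr \<tau> by (intro mult_right_mono mult_left_mono) auto
      also have "\<dots> = max_neg (r i) / 2" by (simp add: \<tau>_def)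
      finally have "D < max_neg (r i)" using mpos[of i] iI by simp
      moreover have "Re (F z) - Re (F a) \<le> D" unfolding D_def norm_minus_cancel
        using complex_Re_le_cmod[of "F z - F a"] by simp
      ultimately have "Re (F z) < 0" using a(2) by linarith
      moreover have "cmod z < 1" using sub[OF zs] r1 by simp
      ultimately show ?thesis by simp
    qed
    then show ?thesis using a(1) by blast
  qed
  then obtain a where a: "\<And>i. i \<in> J \<Longrightarrow> cmod (a i) = r i"
    "\<And>i. i \<in> J \<Longrightarrow> ball (a i) (\<tau> * s) \<subseteq> neg_set" by metis
  have "real (card J) * (pi * (\<tau> * s)^2) \<le> measure lebesgue neg_set"
  proof (rule sum_disjoint_annuli[where a = a and s = "\<tau> * s"])
    show "finite J" by (simp add: J_def)
    show "neg_set \<in> lmeasurable" by (rule negative_set_lmeasurable)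
    fix i j assume ij: "i \<in> J" "j \<in> J" "i < j"
    have "1/2 + real i * s + 2 * (\<tau> * s) \<le> 1/2 + real i * s + 1 * s"
      using \<tau> s by (intro add_mono) auto
    also have "\<dots> \<le> 1/2 + real j * s"
      using mult_right_mono[of "real i + 1" "real j" s] ij s by (simp add: algebra_simps)
    finally show "cmod (a i) + 2 * (\<tau> * s) \<le> cmod (a j)" using a(1) ij by (simp add: r_def)
  next
    fix i assume i: "i \<in> J"
    then have "ball (a i) (\<tau> * s) \<inter> neg_set = ball (a i) (\<tau> * s)" using a(2) by blast
    then show "pi * (\<tau> * s)^2 \<le> measure lebesgue (ball (a i) (\<tau> * s) \<inter> neg_set)"
      using \<tau> s by (simp add: content_disk)
  qed
  moreover have "pi / (2048 * exp (4 * K) * real I) = (real I / 2) * (pi * (\<tau> * s)^2)"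
  proof -
    have "exp (4 * K) = exp (2 * K) * exp (2 * K)" by (simp add: exp_add[symmetric])
    then show ?thesis using I by (simp add: \<tau>_def s_def power2_eq_square)
  qed
  moreover have "(real I / 2) * (pi * (\<tau> * s)^2) \<le> real (card J) * (pi * (\<tau> * s)^2)"
    using cardJ by (intro mult_right_mono) auto
  ultimately show ?thesis by linarith
qed

section \<open>Convexity of the logarithm of the maximum modulus in the logarithm of the
  radius\<close>

definition slope :: "real \<Rightarrow> real \<Rightarrow> real" where
  "slope r r' = (ln (max_mod r') - ln (max_mod r)) / (ln r' - ln r)"

lemma max_mod_mono: "0 \<le> r \<Longrightarrow> r \<le> r' \<Longrightarrow> r' < 1 \<Longrightarrow> max_mod r \<le> max_mod r'"
  using max_mod_attained[of r] max_mod_upper by (metis order_le_less_trans)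

lemma powr_slope: "0 < r \<Longrightarrow> r < r' \<Longrightarrow> 0 < max_mod r \<Longrightarrow> 0 < max_mod r' \<Longrightarrow> max_mod r * (r' / r) powr slope r r' = max_mod r'"
proof -
  assume a: "0 < r" "r < r'" "0 < max_mod r" "0 < max_mod r'"
  then have "ln r' - ln r > 0" by simp
  then have "slope r r' * ln (r' / r) = ln (max_mod r') - ln (max_mod r)" using a by (simp add: slope_def ln_div)
  then show ?thesis using a by (simp add: powr_def exp_diff)
qed

text \<open>The constant \<open>c\<close> and the exponent \<open>slope r1 r2\<close> are those for
  which the power of the radius agrees with \<open>max_mod\<close> on both boundary circles.\<close>

lemma three_circles_slope:
  assumes r: "0 < r1" "r1 < r2" "r2 < 1" and M1: "max_mod r1 > 0" and z: "r1 \<le> cmod z" "cmod z \<le> r2"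
  shows "cmod (F z) \<le> max_mod r1 * (cmod z / r1) powr slope r1 r2"
proof -
  define N where "N = slope r1 r2"
  have M2: "max_mod r2 > 0" using max_mod_mono[of r1 r2] r M1 by simp
  define c where "c = max_mod r1 / r1 powr N"
  have c1: "c * r1 powr N = max_mod r1" using r by (simp add: c_def)
  have c2: "c * r2 powr N = max_mod r2"
    using powr_slope[OF r(1,2) M1 M2] r by (simp add: c_def N_def powr_divide)
  have "cmod (F z) \<le> c * cmod z powr N"
  proof (rule three_circles[OF hol open_ball _ r(1) _ _ z])
    show "{z. r1 \<le> cmod z \<and> cmod z \<le> r2} \<subseteq> ball 0 1" using r by auto
    show "cmod (F w) \<le> c * r1 powr N" if "cmod w = r1" for w
      unfolding c1 using that r by (intro max_mod_upper) auto
    show "cmod (F w) \<le> c * r2 powr N" if "cmod w = r2" for w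
      unfolding c2 using that r by (intro max_mod_upper) auto
  qed
  also have "\<dots> = max_mod r1 * (cmod z / r1) powr N" using r z by (simp add: c_def powr_divide)
  finally show ?thesis by (simp add: N_def)
qed

text \<open>The value of \<open>ln (max_mod r2)\<close> lies below the chord from \<open>r1\<close>
  to \<open>r3\<close>, so the slope of that long chord separates those of the two short
  ones.\<close>

lemma slope_mono:
  assumes r: "0 < r1" "r1 < r2" "r2 < r3" "r3 < 1" and M1: "max_mod r1 > 0"
  shows "slope r1 r2 \<le> slope r2 r3"
proof -
  have M2: "max_mod r2 > 0" and M3: "max_mod r3 > 0" using max_mod_mono[of r1 r2] max_mod_mono[of r1 r3] r M1 by auto
  obtain a where a: "cmod a = r2" "cmod (F a) = max_mod r2" using max_mod_attained[of r2] r by auto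
  have "max_mod r2 \<le> max_mod r1 * (r2 / r1) powr slope r1 r3"
    using three_circles_slope[of r1 r3 a] r a M1 by simp
  then have "ln (max_mod r2) \<le> ln (max_mod r1 * (r2 / r1) powr slope r1 r3)"
    using M2 M1 r by (subst ln_le_cancel_iff) auto
  also have "\<dots> = ln (max_mod r1) + slope r1 r3 * (ln r2 - ln r1)"
    using M1 r by (simp add: ln_mult ln_powr ln_div)
  finally have 1: "ln (max_mod r2) - ln (max_mod r1) \<le> slope r1 r3 * (ln r2 - ln r1)" by simp
  define x where "x = ln r2 - ln r1"
  define y where "y = ln r3 - ln r2"
  have xy: "x > 0" "y > 0" using r by (auto simp: x_def y_def)
  have "slope r1 r3 * (x + y) = ln (max_mod r3) - ln (max_mod r1)"
    using xy by (simp add: slope_def x_def y_def)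
  then have 2: "slope r1 r3 * y \<le> ln (max_mod r3) - ln (max_mod r2)" using 1 by (simp add: x_def algebra_simps)
  have "slope r1 r2 \<le> slope r1 r3" using 1 xy by (simp add: slope_def[of r1 r2] x_def[symmetric] field_simps)
  also have "\<dots> \<le> slope r2 r3" using 2 xy by (simp add: slope_def[of r2 r3] y_def[symmetric] field_simps)
  finally show ?thesis .
qed

text \<open>The slopes \<open>N i\<close> are nondecreasing, start above 42 and end below
  \<open>42 * n\<close>. So at most \<open>2^26 * ln n\<close> steps multiply the slope by more than
  \<open>1 + \<kappa>\<close>. At each of the other steps a maximum point of
  \<open>cmod (F z)\<close> satisfies the growth hypothesis of
  \<open>negative_area_of_steady_growth\<close>.\<close>

lemma fast_growth_case:
  fixes n :: real
  assumes M1: "max_mod (1/4) > 0" and growth: "max_mod (7/8) \<le> exp (6 * n) * max_mod (1/4)" and n: "n \<ge> 1"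
    and I: "real I \<ge> 2^27 * ln n + 2"
    and W: "slope (1/4) (5/8) \<ge> 2^16 * real I / ln (6/5)"
  shows "pi * (ln (6/5))^2 / (2^32 * real I) \<le> measure lebesgue neg_set"
proof -
  define \<sigma> where "\<sigma> = ln (6/5) / real I"
  have I2: "I \<ge> 2"
  proof -
    have "0 \<le> 2^27 * ln n" using n by simp
    then have "real I \<ge> 2" using I by linarith
    then show ?thesis by simp
  qed
  have l65: "0 < ln (6/5::real)" "ln (6/5::real) \<le> 1/5" using ln_le_minus_one[of "6/5::real"] by auto
  have \<sigma>: "0 < \<sigma>" "\<sigma> \<le> 1/5"
    using I2 l65 by (auto simp: \<sigma>_def field_simps intro: order_trans)
  \<comment> \<open>Geometric progression from 5/8 to 3/4, so that consecutive radii are equally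
    spaced, by \<open>\<sigma>\<close>, on the logarithmic scale.\<close>
  define \<rho> where "\<rho> i = 5/8 * exp (real i * \<sigma>)" for i :: nat
  have \<rho>0: "\<rho> 0 = 5/8" and \<rho>I: "\<rho> I = 3/4" using I2 by (auto simp: \<rho>_def \<sigma>_def)
  have \<rho>mono: "\<rho> i < \<rho> j" if "i < j" for i j using that \<sigma> by (simp add: \<rho>_def)
  have \<rho>le: "\<rho> i \<le> \<rho> j" if "i \<le> j" for i j using that \<sigma> by (simp add: \<rho>_def)
  have \<rho>b: "5/8 \<le> \<rho> i" "\<rho> i \<le> 3/4" if "i \<le> I" for i
    using \<rho>le[of 0 i] \<rho>le[of i I] that \<rho>0 \<rho>I by auto
  have \<rho>S: "\<rho> (Suc i) = \<rho> i * exp \<sigma>" for i by (simp add: \<rho>_def exp_add[symmetric] algebra_simps)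
  have gap: "\<rho> i + 5/8 * \<sigma> \<le> \<rho> (Suc i)" if "i \<le> I" for i
  proof -
    have "\<rho> i + 5/8 * \<sigma> \<le> \<rho> i + \<rho> i * \<sigma>" using \<rho>b[OF that] \<sigma> by (intro add_mono mult_right_mono) auto
    also have "\<dots> = \<rho> i * (1 + \<sigma>)" by (simp add: algebra_simps)
    also have "\<dots> \<le> \<rho> i * exp \<sigma>" using \<rho>b[OF that] by (intro mult_left_mono) auto
    finally show ?thesis by (simp add: \<rho>S)
  qed
  have lnS: "ln (\<rho> (Suc i)) - ln (\<rho> i) = \<sigma>" for i unfolding \<rho>S by (subst ln_mult) (auto simp: \<rho>_def)
  have Mpos: "max_mod r > 0" if "1/4 \<le> r" "r < 1" for r using max_mod_mono[of "1/4" r] that M1 by simp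
  define N where "N i = slope (\<rho> i) (\<rho> (Suc i))" for i
  have Nmono: "N i \<le> N (Suc i)" if "Suc (Suc i) \<le> I" for i
    unfolding N_def using that \<rho>b[of i] \<rho>b[of "Suc (Suc i)"] \<rho>mono
    by (intro slope_mono Mpos) auto
  \<comment> \<open>With \<open>s = \<sigma> / 8\<close> below, \<open>W0 * s\<close> is exactly the
    \<open>2^13\<close> that steady growth requires.\<close>
  define W0 where "W0 = 2^16 * real I / ln (6/5)"
  have W0: "W0 > 42"
  proof -
    have "2^16 * 2 * 1 \<le> 2^16 * real I * 1" using I2 by (intro mult_mono) auto
    also have "\<dots> \<le> 2^16 * real I * (1 / ln (6/5))" using l65 by (intro mult_left_mono) (auto simp: field_simps)
    finally show ?thesis by (simp add: W0_def)
  qed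
  have N0: "W0 \<le> N 0"
  proof -
    have "slope (1/4) (5/8) \<le> slope (5/8) (\<rho> (Suc 0))"
      using \<rho>mono[of 0 "Suc 0"] \<rho>b[of "Suc 0"] I2 M1 \<rho>0 by (intro slope_mono) auto
    then show ?thesis using W by (simp add: N_def W0_def \<rho>0)
  qed
  have Nlast: "N (I - 1) \<le> 42 * n"
  proof -
    have II: "Suc (I - 1) = I" using I2 by simp
    have "N (I - 1) \<le> slope (3/4) (7/8)"
      unfolding N_def II \<rho>I using \<rho>mono[of "I - 1" I] \<rho>b[of "I - 1"] I2 \<rho>I
      by (intro slope_mono Mpos) auto
    also have "\<dots> \<le> 42 * n"
    proof -
      have "ln (max_mod (7/8)) \<le> ln (exp (6 * n) * max_mod (1/4))"
        using growth Mpos[of "7/8"] M1 by (subst ln_le_cancel_iff) auto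
      also have "\<dots> = 6 * n + ln (max_mod (1/4))" using M1 by (simp add: ln_mult)
      also have "ln (max_mod (1/4)) \<le> ln (max_mod (3/4))" using max_mod_mono[of "1/4" "3/4"] M1 by (subst ln_le_cancel_iff) auto
      finally have 1: "ln (max_mod (7/8)) - ln (max_mod (3/4)) \<le> 6 * n" by simp
      have "ln (6/7::real) \<le> 6/7 - 1" by (rule ln_le_minus_one) simp
      then have 2: "1/7 \<le> ln (7/8::real) - ln (3/4)"
        proof -
        assume le: "ln (6/7::real) \<le> 6/7 - 1"
        have "ln (7/8::real) - ln (3/4) = ln ((7/8) / (3/4))" by (subst ln_div) auto
        also have "\<dots> = ln (inverse (6/7))" by simp
        also have "\<dots> = - ln (6/7)" by (rule ln_inverse)
        finally show ?thesis using le by simp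
      qed
      have "slope (3/4) (7/8) \<le> 6 * n / (1/7)"
        unfolding slope_def using 1 2 n by (intro frac_le) auto
      then show ?thesis by simp
    qed
    finally show ?thesis .
  qed
  \<comment> \<open>Within distance \<open>s\<close> the logarithm of the radius changes by at most
    \<open>8 * s\<close>, so an excess slope \<open>\<kappa> * N j\<close> costs the factor
    \<open>exp (N j * s / 2^22)\<close> that is allowed.\<close>
  define \<kappa> :: real where "\<kappa> = 1 / 2^25"
  define B where "B k = {i\<in>{1..k}. N i > (1 + \<kappa>) * N (i - 1)}" for k
  have fB: "finite (B k)" for k by (simp add: B_def)
  have count: "W0 * (1 + \<kappa>) ^ card (B k) \<le> N k" if "k \<le> I - 1" for k using that
  proof (induction k)
    case 0
    then show ?case using N0 by (simp add: B_def)
  next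
    case (Suc k)
    show ?case
    proof (cases "N (Suc k) > (1 + \<kappa>) * N k")
      case True
      then have "B (Suc k) = insert (Suc k) (B k)" by (auto simp: B_def le_Suc_eq)
      moreover have "Suc k \<notin> B k" by (simp add: B_def)
      ultimately have "W0 * (1 + \<kappa>) ^ card (B (Suc k)) = (1 + \<kappa>) * (W0 * (1 + \<kappa>) ^ card (B k))"
        using fB by simp
      also have "\<dots> \<le> (1 + \<kappa>) * N k" using Suc by (intro mult_left_mono) (auto simp: \<kappa>_def)
      finally show ?thesis using True by simp
    next
      case False
      then have "B (Suc k) = B k" by (auto simp: B_def le_Suc_eq)
      moreover have "N k \<le> N (Suc k)" using Suc.prems I2 by (intro Nmono) linarith
      moreover have "W0 * (1 + \<kappa>) ^ card (B k) \<le> N k" using Suc by simp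
      ultimately show ?thesis by simp
    qed
  qed
  have cardB: "real (card (B (I - 1))) \<le> 2^26 * ln n"
  proof -
    define u where "u = card (B (I - 1))"
    have "42 * (1 + \<kappa>) ^ u \<le> W0 * (1 + \<kappa>) ^ u" using W0 by (intro mult_right_mono) (auto simp: \<kappa>_def)
    also have "\<dots> \<le> 42 * n" using count[of "I - 1"] Nlast by (simp add: u_def)
    finally have "(1 + \<kappa>) ^ u \<le> n" by simp
    then have "ln ((1 + \<kappa>) ^ u) \<le> ln n" using n by (subst ln_le_cancel_iff) (auto simp: \<kappa>_def)
    then have "real u * ln (1 + \<kappa>) \<le> ln n" by (subst (asm) ln_realpow) (auto simp: \<kappa>_def)
    moreover have "1 / 2^26 \<le> ln (1 + \<kappa>)"
    proof -
      have "ln (1 / (1 + \<kappa>)) \<le> 1 / (1 + \<kappa>) - 1" by (rule ln_le_minus_one) (simp add: \<kappa>_def)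
      moreover have "ln (1 / (1 + \<kappa>)) = - ln (1 + \<kappa>)" by (simp add: ln_div \<kappa>_def)
      moreover have "1 / (1 + \<kappa>) - 1 \<le> - (1/2^26)" by (simp add: \<kappa>_def)
      ultimately show ?thesis by linarith
    qed
    then have "real u * (1 / 2^26) \<le> real u * ln (1 + \<kappa>)" by (intro mult_left_mono) auto
    ultimately have "real u * (1 / 2^26) \<le> ln n" by linarith
    then show ?thesis by (simp add: u_def)
  qed
  \<comment> \<open>Index 0 has no preceding slope to compare with; the \<open>+ 2\<close> in the
    assumption on \<open>I\<close> pays for its loss.\<close>
  define J where "J = {1..I-1} - B (I - 1)"
  have cardJ: "real I \<le> 2 * real (card J)"
  proof -
    have "card J = (I - 1) - card (B (I - 1))" unfolding J_def
      by (subst card_Diff_subset) (auto simp: B_def)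
    then have "real (card J) \<ge> real I - 1 - real (card (B (I - 1)))" using I2 by linarith
    moreover have "2^27 * ln n = 2 * (2^26 * ln n)" by simp
    ultimately show ?thesis using cardB I by linarith
  qed
  define s where "s = \<sigma> / 8"
  have s: "0 < s" "s \<le> 1/4" using \<sigma> by (auto simp: s_def)
  have Ngt: "W0 \<le> N i" if "i \<le> I - 1" for i
  proof -
    have "W0 * 1 \<le> W0 * (1 + \<kappa>) ^ card (B i)" using W0 by (intro mult_left_mono one_le_power) (auto simp: \<kappa>_def)
    then show ?thesis using count[OF that] by simp
  qed
  have "\<exists>a. cmod a = \<rho> i \<and> pi * s^2 / 2^25 \<le> measure lebesgue (ball a s \<inter> {z. Re (F z) < 0})" if i: "i \<in> J" for i
  proof -
    obtain j where j: "i = Suc j" using i by (cases i) (auto simp: J_def)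
    have iI: "i \<le> I - 1" "Suc i \<le> I" "i \<le> I" "j \<le> I" using i I2 j by (auto simp: J_def)
    have st: "N i \<le> (1 + \<kappa>) * N j" using i j by (auto simp: J_def B_def)
    obtain a where a: "cmod a = \<rho> i" "cmod (F a) = max_mod (\<rho> i)"
      using max_mod_attained[of "\<rho> i"] \<rho>b[OF iI(3)] by auto
    have ai: "5/8 \<le> cmod a" "cmod a \<le> 3/4" using a \<rho>b[OF iI(3)] by auto
    have NJ: "N j \<ge> W0" using Ngt[of j] iI j by simp
    have "pi * s^2 / 2^25 \<le> measure lebesgue (ball a s \<inter> {z. Re (F z) < 0})"
    proof (rule negative_area_of_steady_growth[of F a s "N j"])
      show "F holomorphic_on ball a s"
      proof (rule holomorphic_on_subset[OF hol], rule subsetI)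
        fix z assume "z \<in> ball a s"
        then show "z \<in> ball 0 1" using norm_triangle_ineq[of "z - a" a] ai s
          by (simp add: dist_norm norm_minus_commute)
      qed
      show "F a \<noteq> 0" using a Mpos[of "\<rho> i"] \<rho>b[OF iI(3)] by auto
      show "2^13 \<le> N j * s"
      proof -
        have "2^13 = W0 * s" using I2 l65 by (simp add: W0_def s_def \<sigma>_def)
        also have "\<dots> \<le> N j * s" using NJ s by (intro mult_right_mono) auto
        finally show ?thesis .
      qed
      show "1/2 \<le> cmod a" "cmod a \<le> 1" "0 < s" "s \<le> 1/4" using ai s by auto
      fix z assume "z \<in> ball a s"
      then have "cmod (z - a) < s" by (simp add: dist_norm norm_minus_commute)
      then have zr: "\<rho> i - s < cmod z" "cmod z < \<rho> i + s" using a(1) norm_triangle_ineq3[of z a] by auto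
      have Mj: "max_mod (\<rho> j) * (\<rho> i / \<rho> j) powr N j = max_mod (\<rho> i)"
        unfolding N_def j using \<rho>b[of j] \<rho>b[of "Suc j"] \<rho>mono[of j "Suc j"] iI j by (intro powr_slope Mpos) auto
      have pj: "\<rho> j > 0" "\<rho> i > 0" by (auto simp: \<rho>_def)
      have zpos: "cmod z > 0" using zr(1) \<rho>b[OF iI(3)] s by linarith
      have e1: "1 \<le> exp (N j * s / 2^22)" using NJ W0 s by simp
      show "cmod (F z) \<le> cmod (F a) * (cmod z / cmod a) powr N j * exp (N j * s / 2^22)"
      \<comment> \<open>Inside the circle through \<open>a\<close> the chord ending there has slope
        \<open>N j\<close>. Outside only the next slope \<open>N i\<close> is available, which is
        larger by a factor of at most \<open>1 + \<kappa>\<close>.\<close>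
      proof (cases "cmod z \<le> \<rho> i")
        case True
        have "\<rho> j \<le> \<rho> i - s"
          using gap[of j] iI j s \<sigma> by (simp add: s_def)
        then have "cmod (F z) \<le> max_mod (\<rho> j) * (cmod z / \<rho> j) powr N j"
          unfolding N_def j[symmetric] using True zr pj \<rho>b[OF iI(3)] \<rho>b[OF iI(4)] \<rho>mono[of j i] j
          by (intro three_circles_slope Mpos) auto
        also have "cmod z / \<rho> j = (\<rho> i / \<rho> j) * (cmod z / \<rho> i)" using pj by simp
        also have "max_mod (\<rho> j) * \<dots> powr N j = max_mod (\<rho> i) * (cmod z / \<rho> i) powr N j"
          using pj zpos by (subst powr_mult) (auto simp: Mj[symmetric])
        also have "\<dots> \<le> max_mod (\<rho> i) * (cmod z / \<rho> i) powr N j * exp (N j * s / 2^22)"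
          using mult_left_mono[OF e1, of "max_mod (\<rho> i) * (cmod z / \<rho> i) powr N j"] Mpos[of "\<rho> i"] \<rho>b[OF iI(3)] by simp
        finally show ?thesis using a by simp
      next
        case False
        have "cmod z \<le> \<rho> (Suc i)" using gap[of i] iI s \<sigma> zr by (simp add: s_def)
        then have le: "cmod (F z) \<le> max_mod (\<rho> i) * (cmod z / \<rho> i) powr N i"
          unfolding N_def using False pj \<rho>b[OF iI(3)] \<rho>b[OF iI(2)] \<rho>mono[of i "Suc i"]
          by (intro three_circles_slope Mpos) auto
        define t where "t = ln (cmod z / \<rho> i)"
        have t0: "t \<ge> 0" using False pj by (simp add: t_def)
        have "t \<le> cmod z / \<rho> i - 1" unfolding t_def using zpos pj by (intro ln_le_minus_one) auto
        also have "\<dots> = (cmod z - \<rho> i) / \<rho> i" using pj by (simp add: field_simps)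
        also have "\<dots> \<le> s / (5/8)" using zr \<rho>b[OF iI(3)] False by (intro frac_le) auto
        finally have ts: "t \<le> 8 * s" using s by simp
        have "(N i - N j) * t \<le> (\<kappa> * N j) * (8 * s)"
          using st ts t0 s NJ W0 by (intro mult_mono) (auto simp: \<kappa>_def algebra_simps)
        also have "\<dots> = N j * s / 2^22" by (simp add: \<kappa>_def)
        finally have ex: "N i * t \<le> N j * t + N j * s / 2^22" by (simp add: algebra_simps)
        have "(cmod z / \<rho> i) powr N i = exp (N i * t)" using zpos pj by (simp add: powr_def t_def)
        also have "\<dots> \<le> exp (N j * t) * exp (N j * s / 2^22)" using ex by (simp add: exp_add[symmetric])
        also have "exp (N j * t) = (cmod z / \<rho> i) powr N j" using zpos pj by (simp add: powr_def t_def)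
        finally have "max_mod (\<rho> i) * (cmod z / \<rho> i) powr N i \<le> max_mod (\<rho> i) * ((cmod z / \<rho> i) powr N j * exp (N j * s / 2^22))"
          using Mpos[of "\<rho> i"] \<rho>b[OF iI(3)] by (intro mult_left_mono) auto
        then show ?thesis using le a by (simp add: mult.assoc)
      qed
    qed
    then show ?thesis using a(1) by blast
  qed
  then obtain a where a: "\<And>i. i \<in> J \<Longrightarrow> cmod (a i) = \<rho> i"
    "\<And>i. i \<in> J \<Longrightarrow> pi * s^2 / 2^25 \<le> measure lebesgue (ball (a i) s \<inter> {z. Re (F z) < 0})" by metis
  have "real (card J) * (pi * s^2 / 2^25) \<le> measure lebesgue neg_set"
  proof (rule sum_disjoint_annuli[where a = a and s = s])
    show "finite J" by (simp add: J_def)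
    show "neg_set \<in> lmeasurable" by (rule negative_set_lmeasurable)
    fix i j assume ij: "i \<in> J" "j \<in> J" "i < j"
    then have "i \<le> I" by (auto simp: J_def)
    then have "\<rho> i + 2 * s \<le> \<rho> (Suc i)" using gap[of i] \<sigma> by (simp add: s_def)
    also have "\<dots> \<le> \<rho> j" using ij by (intro \<rho>le) auto
    finally show "cmod (a i) + 2 * s \<le> cmod (a j)" using a(1) ij by simp
  next
    fix i assume i: "i \<in> J"
    then have "ball (a i) s \<subseteq> ball 0 1"
    proof -
      have "cmod (a i) \<le> 3/4" using a(1) i \<rho>b(2)[of i] by (auto simp: J_def)
      then have "cmod z < 1" if "cmod (z - a i) < s" for z
        using that s norm_triangle_ineq[of "z - a i" "a i"] by simp
      then show ?thesis by (auto simp: dist_norm norm_minus_commute)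
    qed
    then have "ball (a i) s \<inter> neg_set = ball (a i) s \<inter> {z. Re (F z) < 0}" by blast
    then show "pi * s^2 / 2^25 \<le> measure lebesgue (ball (a i) s \<inter> neg_set)" using a(2)[OF i] by simp
  qed
  moreover have "pi * (ln (6/5))^2 / (2^32 * real I) = (real I / 2) * (pi * s^2 / 2^25)"
    using I2 by (simp add: s_def \<sigma>_def power2_eq_square)
  moreover have "(real I / 2) * (pi * s^2 / 2^25) \<le> real (card J) * (pi * s^2 / 2^25)"
    using cardJ by (intro mult_right_mono) auto
  ultimately show ?thesis by linarith
qed

text \<open>The growth of \<open>max_neg\<close> from 1/2 to 5/8 decides between the two cases. Fast
  growth passes to \<open>max_mod\<close>, because
  \<open>max_mod (1/4) \<le> 2 * max_neg (1/2)\<close> and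
  \<open>max_neg (5/8) \<le> max_mod (5/8)\<close>; it forces the large initial slope, while the
  growth assumption limits the later ones.\<close>

lemma negative_area_lower_bound:
  fixes n :: real
  assumes n: "n \<ge> 3" and z1: "cmod z1 = 1/4" "F z1 \<noteq> 0"
    and growth: "\<And>z. cmod z = 7/8 \<Longrightarrow> cmod (F z) \<le> exp (6 * n) * cmod (F z1)"
  shows "pi / (2^60 * exp (2^22)) / ln n \<le> measure lebesgue neg_set"
proof -
  have ln1: "ln n \<ge> 1"
  proof -
    have "exp 1 \<le> n" using n exp_le by linarith
    then show ?thesis using n by (simp add: ln_ge_iff)
  qed
  define I where "I = nat \<lceil>2^28 * ln n\<rceil>"
  have I: "real I \<ge> 2^28 * ln n" "real I \<le> 2^28 * ln n + 1" using ln1 by (auto simp: I_def)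
  have ln0: "ln n > 0" using ln1 by simp
  have I0: "I > 0" using I(1) ln1 by (intro gr0I) auto
  have I': "real I \<le> 2^29 * ln n" using I(2) ln1 by simp
  have Mz: "max_mod (1/4) > 0" using max_mod_upper[of z1 "1/4"] z1 by (metis order_less_le_trans zero_less_norm_iff order_refl divide_less_eq_1_pos one_less_numeral_iff semiring_norm(76) zero_less_numeral)
  have Mg: "max_mod (7/8) \<le> exp (6 * n) * max_mod (1/4)"
  proof -
    obtain a where "cmod a = 7/8" "cmod (F a) = max_mod (7/8)" using max_mod_attained[of "7/8"] by auto
    then have "max_mod (7/8) \<le> exp (6 * n) * cmod (F z1)" using growth by metis
    also have "\<dots> \<le> exp (6 * n) * max_mod (1/4)" using max_mod_upper[of z1 "1/4"] z1 by (intro mult_left_mono) auto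
    finally show ?thesis .
  qed
  have M4: "max_mod (1/4) \<le> 2 * max_neg (1/2)"
  proof -
    obtain a where a: "cmod a = 1/4" "cmod (F a) = max_mod (1/4)" using max_mod_attained[of "1/4"] by auto
    have "max_mod (1/4) * (1/2 - 1/4) \<le> 2 * max_neg (1/2) * (1/4)" using max_neg_controls_modulus[of a "1/2"] unfolding a by simp
    then show ?thesis by simp
  qed
  have m0: "max_neg (1/2) > 0" using M4 Mz by simp
  \<comment> \<open>Large enough for the slope needed in the fast case; in the slow case its price
    is the factor \<open>exp (4 * K) = exp (2^22)\<close>.\<close>
  define K :: real where "K = 2^20"
  define R where "R = pi / (2^60 * exp (2^22)) / ln n"
  show ?thesis
  proof (cases "max_neg (5/8) \<le> exp (K * real I) * max_neg (1/2)")
    case True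
    have "R \<le> pi / (2048 * exp (4 * K) * real I)"
    proof -
      have "2048 * exp (4 * K) * real I \<le> 2048 * exp (4 * K) * (2^29 * ln n)" using I' by (intro mult_left_mono) auto
      also have "\<dots> \<le> 2^60 * exp (2^22) * ln n" using ln1 by (simp add: K_def)
      finally show ?thesis unfolding R_def divide_divide_eq_left using I0 by (intro divide_left_mono) (auto intro!: mult_pos_pos simp: ln0)
    qed
    also have "\<dots> \<le> measure lebesgue neg_set" using True I0 m0 by (intro slow_growth_case) (auto simp: K_def)
    finally show ?thesis by (simp add: R_def)
  next
    case False
    have l65: "1/6 \<le> ln (6/5::real)" "ln (6/5::real) > 0"
      using ln_le_minus_one[of "5/6::real"] ln_inverse[of "6/5::real"] by auto
    obtain b where b: "cmod b = 5/8" "- Re (F b) = max_neg (5/8)" using max_neg_attained[of "5/8"] by auto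
    have "max_neg (5/8) \<le> cmod (F b)" using b(2) abs_Re_le_cmod[of "F b"] by linarith
    also have "\<dots> \<le> max_mod (5/8)" using b(1) by (intro max_mod_upper) auto
    finally have "exp (K * real I) * (max_mod (1/4) / 2) \<le> max_mod (5/8)"
    proof -
      assume le: "max_neg (5/8) \<le> max_mod (5/8)"
      have "exp (K * real I) * (max_mod (1/4) / 2) \<le> exp (K * real I) * max_neg (1/2)"
        using M4 by (intro mult_left_mono) auto
      then show ?thesis using False le by linarith
    qed
    then have "ln (exp (K * real I) * (max_mod (1/4) / 2)) \<le> ln (max_mod (5/8))"
      using Mz by (intro ln_mono) auto
    then have "K * real I + (ln (max_mod (1/4)) - ln 2) \<le> ln (max_mod (5/8))" using Mz by (simp add: ln_mult ln_div)
    moreover have "ln 2 \<le> (1::real)" using ln_le_minus_one[of "2::real"] by simp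
    ultimately have inc: "K * real I - 1 \<le> ln (max_mod (5/8)) - ln (max_mod (1/4))" by linarith
    have d: "0 < ln (5/8::real) - ln (1/4)" "ln (5/8::real) - ln (1/4) \<le> 3/2"
      using ln_le_minus_one[of "5/2::real"] ln_div[of "5/8::real" "1/4"] by auto
    have KI: "2^19 * real I * (3/2) \<le> K * real I - 1" using I0 by (simp add: K_def)
    have "2^16 * real I / ln (6/5) \<le> 2^16 * real I / (1/6)" using l65 by (intro divide_left_mono) auto
    also have "\<dots> \<le> 2^19 * real I" by simp
    also have "\<dots> = 2^19 * real I * (3/2) / (3/2)" by simp
    also have "\<dots> \<le> (ln (max_mod (5/8)) - ln (max_mod (1/4))) / (ln (5/8) - ln (1/4))"
      using KI inc d I0 by (intro frac_le) auto
    finally have W: "slope (1/4) (5/8) \<ge> 2^16 * real I / ln (6/5)" by (simp add: slope_def)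
    have "R \<le> pi * (1/6)^2 / (2^32 * real I)"
    proof -
      have "36 * (2^32 * real I) \<le> 36 * 2^32 * (2^29 * ln n)" using I' by simp
      also have "\<dots> \<le> 2^67 * ln n" using ln1 by simp
      also have "\<dots> \<le> (2^60 * exp (2^22)) * ln n"
      proof -
        have "(2::real)^7 \<le> exp (2^22)" using exp_ge_add_one_self[of "2^22::real"] by simp
        then have "2^60 * (2::real)^7 \<le> 2^60 * exp (2^22)" by (intro mult_left_mono) auto
        then show ?thesis using ln1 by (intro mult_right_mono) auto
      qed
      finally have le: "36 * (2^32 * real I) \<le> (2^60 * exp (2^22)) * ln n" .
      have "R \<le> pi / (36 * (2^32 * real I))"
        unfolding R_def divide_divide_eq_left using I0 le ln1 by (intro divide_left_mono) (auto intro!: mult_pos_pos simp: ln0)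
      then show ?thesis by (simp add: power2_eq_square)
    qed
    also have "\<dots> \<le> pi * (ln (6/5))^2 / (2^32 * real I)"
      using l65 by (intro divide_right_mono mult_left_mono power_mono) auto
    also have "\<dots> \<le> measure lebesgue neg_set"
      using I ln1 n by (intro fast_growth_case[OF Mz Mg _ _ W]) auto
    finally show ?thesis by (simp add: R_def)
  qed
qed

end

section \<open>The lower bound for lemniscates\<close>

text \<open>A Bernstein-Walsh type bound: inversion turns the circle of radius \<open>1/R\<close>
  into that of radius \<open>R\<close>, where the maximum principle for the reflected polynomial
  applies.\<close>

lemma poly_growth_outside_disk:
  fixes r :: "complex poly"
  assumes R: "R \<ge> 1" and deg: "degree r \<le> n" and b: "\<And>z. cmod z \<le> 1/R \<Longrightarrow> cmod (poly r z) \<le> \<delta>" and z: "cmod z \<le> 1"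
  shows "cmod (poly r z) \<le> R^n * \<delta>"
proof (cases "cmod z \<le> 1/R")
  case True
  have "\<delta> \<ge> 0" using b[of 0] R norm_ge_zero[of "poly r 0"] by (simp del: norm_ge_zero)
  then have "1 * \<delta> \<le> R^n * \<delta>" using R by (intro mult_right_mono one_le_power) auto
  then show ?thesis using b[OF True] by simp
next
  case False
  define d where "d = degree r"
  define u where "u = inverse z"
  have "1 / R > 0" using R by simp
  then have z0: "cmod z > 0" "z \<noteq> 0" using False by (linarith, auto)
  have u: "1 \<le> cmod u" "cmod u \<le> R" using z z0 False R by (auto simp: u_def norm_divide inverse_eq_divide field_simps)
  have \<delta>: "\<delta> \<ge> 0" using b[of 0] R norm_ge_zero[of "poly r 0"] by (simp del: norm_ge_zero)
  have "cmod (poly (reflect_poly r) u) \<le> R^d * \<delta>"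
  proof (rule maximum_modulus_frontier[of "poly (reflect_poly r)" "cball 0 R"])
    show "cmod (poly (reflect_poly r) w) \<le> R^d * \<delta>" if "w \<in> frontier (cball 0 R)" for w
    proof -
      have w: "cmod w = R" using that by (simp add: dist_norm)
      then have w0: "w \<noteq> 0" using R by auto
      have "cmod (poly (reflect_poly r) w) = R^d * cmod (poly r (inverse w))"
        using w by (simp add: poly_reflect_poly_nz[OF w0] norm_mult norm_power d_def)
      also have "\<dots> \<le> R^d * \<delta>" using w R by (intro mult_left_mono b) (auto simp: norm_divide inverse_eq_divide)
      finally show ?thesis .
    qed
  next
    show "u \<in> cball 0 R" using u by simp
    show "poly (reflect_poly r) holomorphic_on interior (cball 0 R)" by (intro holomorphic_intros)
    show "continuous_on (closure (cball 0 R)) (poly (reflect_poly r))" by (intro continuous_intros)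
    show "bounded (cball (0::complex) R)" by simp
  qed
  moreover have "poly (reflect_poly r) u = u^d * poly r z"
    using z0 by (subst poly_reflect_poly_nz) (auto simp: u_def d_def)
  ultimately have "cmod u ^ d * cmod (poly r z) \<le> R^d * \<delta>" by (simp add: norm_mult norm_power)
  moreover have "1 * cmod (poly r z) \<le> cmod u ^ d * cmod (poly r z)"
    using u by (intro mult_right_mono one_le_power) auto
  moreover have "R^d * \<delta> \<le> R^n * \<delta>"
    using R deg \<delta> by (intro mult_right_mono power_increasing) (auto simp: d_def)
  ultimately show ?thesis by linarith
qed

section \<open>Factorisation and area of lemniscates\<close>

lemma monic_poly_as_prod:
  assumes "p \<in> monic_polys_zeros_in n (cball 0 1)"
  obtains w :: "nat \<Rightarrow> complex" where "\<And>z. poly p z = (\<Prod>i<n. z - w i)" "\<And>i. i < n \<Longrightarrow> cmod (w i) \<le> 1"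
proof -
  have p: "degree p = n" "lead_coeff p = 1" "\<And>z. poly p z = 0 \<Longrightarrow> cmod z \<le> 1"
    using assms by (auto simp: monic_polys_zeros_in_def)
  obtain w where "smult (lead_coeff p) (\<Prod>i<degree p. [:-w i, 1:]) = p"
    using complex_poly_decompose' by blast
  then have "p = (\<Prod>i<n. [:-w i, 1:])" using p by simp
  then have e: "poly p z = (\<Prod>i<n. z - w i)" for z by (simp add: poly_prod)
  have "cmod (w i) \<le> 1" if i: "i < n" for i
  proof -
    have "poly p (w i) = 0" unfolding e using i by (intro prod_zero) auto
    then show ?thesis by (rule p(3))
  qed
  with e show ?thesis using that by blast
qed

text \<open>Where \<open>cmod z \<ge> 2\<close>, every factor of \<open>p\<close> has modulus at
  least 1, which confines the open lemniscate.\<close>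

lemma lemniscate_lmeasurable:
  assumes "p \<in> monic_polys_zeros_in n (cball 0 1)" "n > 0"
  shows "lemniscate p \<in> lmeasurable" "lemniscate p \<subseteq> ball 0 2"
proof -
  obtain w where w: "\<And>z. poly p z = (\<Prod>i<n. z - w i)" "\<And>i. i < n \<Longrightarrow> cmod (w i) \<le> 1"
    using monic_poly_as_prod[OF assms(1)] by blast
  have "cmod z < 2" if z: "cmod (poly p z) < 1" for z
  proof (rule ccontr)
    assume "\<not> cmod z < 2"
    then have "1 \<le> cmod (z - w i)" if "i < n" for i
      using w(2)[OF that] norm_triangle_ineq2[of z "w i"] by linarith
    then have "1 \<le> (\<Prod>i<n. cmod (z - w i))" by (intro prod_ge_1) auto
    then show False using z by (simp add: w(1) prod_norm)
  qed
  then show sub: "lemniscate p \<subseteq> ball 0 2" by (auto simp: lemniscate_def)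
  have "open {z. cmod (poly p z) < 1}" by (intro open_Collect_less continuous_intros)
  then show "lemniscate p \<in> lmeasurable" unfolding lemniscate_def[symmetric]
    by (intro lmeasurable_open bounded_subset[OF bounded_ball sub]) auto
qed

text \<open>Replacing each factor \<open>z - w\<close> by the larger \<open>1 - cnj w * z\<close> reduces to a zero-free polynomial on the
  unit disc with value 1 at the origin.\<close>

lemma lemniscate_area_lower_bound:
  assumes p: "p \<in> monic_polys_zeros_in n (cball 0 1)" and n: "n \<ge> 3"
  shows "pi / (2^60 * exp (2^22)) / ln (real n) \<le> measure lebesgue (lemniscate p)"
proof -
  obtain w where w: "\<And>z. poly p z = (\<Prod>i<n. z - w i)" "\<And>i. i < n \<Longrightarrow> cmod (w i) \<le> 1"
    using monic_poly_as_prod[OF p] by blast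
  define q where "q = (\<Prod>i<n. [:1, - cnj (w i):])"
  define F where "F z = (\<Sum>i<n. Ln (1 - cnj (w i) * z))" for z
  have pq: "poly q z = (\<Prod>i<n. 1 - cnj (w i) * z)" for z by (simp add: q_def poly_prod mult.commute)
  have degq: "degree q \<le> n" unfolding q_def
    
  proof (rule order_trans[OF degree_prod_sum_le])
    have "sum (degree \<circ> (\<lambda>i. [:1, - cnj (w i):])) {..<n} \<le> (\<Sum>i<n. 1)" by (intro sum_mono) simp
    then show "sum (degree \<circ> (\<lambda>i. [:1, - cnj (w i):])) {..<n} \<le> n" by simp
  qed simp
  have lt: "cmod (cnj (w i) * z) < 1" if "cmod z < 1" "i < n" for i z
  proof -
    have "cmod (w i) * cmod z \<le> 1 * cmod z" using w(2)[OF that(2)] by (rule mult_right_mono) simp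
    then show ?thesis using that by (simp add: norm_mult)
  qed
  have pos: "0 < Re (1 - cnj (w i) * z)" if "cmod z < 1" "i < n" for i z
    using lt[OF that] complex_Re_le_cmod[of "cnj (w i) * z"] by simp
  have expF: "exp (F z) = poly q z" if "cmod z < 1" for z
    unfolding F_def pq exp_sum[OF finite_lessThan]
  proof (rule prod.cong[OF refl])
    fix i assume "i \<in> {..<n}"
    then have "1 - cnj (w i) * z \<noteq> 0" using pos[OF that, of i] by (metis lessThan_iff less_irrefl zero_complex.simps(1))
    then show "exp (Ln (1 - cnj (w i) * z)) = 1 - cnj (w i) * z" by (rule exp_Ln)
  qed
  have hol: "F holomorphic_on ball 0 1"
    unfolding F_def
  proof (intro holomorphic_intros)
    fix z :: complex and i assume "z \<in> ball 0 1" "i \<in> {..<n}"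
    then show "1 - cnj (w i) * z \<notin> \<real>\<^sub>\<le>\<^sub>0" using pos[of z i] by (auto simp: complex_nonpos_Reals_iff)
  qed
  have F0: "F 0 = 0" by (simp add: F_def)
  have Req: "exp (Re (F z)) = cmod (poly q z)" if "cmod z < 1" for z using expF[OF that] by (metis norm_exp_eq_Re)
  have le: "cmod (poly p z) \<le> cmod (poly q z)" if z: "cmod z < 1" for z
    unfolding w(1) pq prod_norm[symmetric]
  proof (intro prod_mono conjI norm_ge_zero)
    fix i assume "i \<in> {..<n}"
    then have wi: "cmod (w i) \<le> 1" using w(2) by simp
    have "(cmod (1 - cnj (w i) * z))^2 - (cmod (z - w i))^2 = (1 - (cmod z)^2) * (1 - (cmod (w i))^2)"
      unfolding cmod_power2 by (simp add: power2_eq_square algebra_simps)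
    moreover have "0 \<le> (1 - (cmod z)^2) * (1 - (cmod (w i))^2)"
      using z wi by (intro mult_nonneg_nonneg) (auto simp: power_le_one)
    ultimately have "(cmod (z - w i))^2 \<le> (cmod (1 - cnj (w i) * z))^2" by linarith
    then show "cmod (z - w i) \<le> cmod (1 - cnj (w i) * z)"
      by (rule power2_le_imp_le) simp
  qed
  have n0: "n > 0" using n by simp
  note lm = lemniscate_lmeasurable(1)[OF p n0]
  have ln1: "ln (real n) \<ge> 1"
  proof -
    have "exp 1 \<le> real n" using n exp_le by linarith
    then show ?thesis using n by (simp add: ln_ge_iff)
  qed
  show ?thesis
  proof (cases "\<exists>z. cmod z = 1/4 \<and> F z \<noteq> 0")
    \<comment> \<open>The degenerate case, which includes the pure power: \<open>q = 1\<close>, so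
      \<open>p\<close> is bounded by 1 on the unit disc, and the maximum principle puts the whole
      disc into the lemniscate.\<close>
    case False
    have "F z = 0" if "cmod z \<le> 1/4" for z
    proof -
      obtain a where "cmod a = 1/4" "cmod (F a) = max_mod F (1/4)"
        using max_mod_attained[OF hol F0, of "1/4"] by auto
      then have "max_mod F (1/4) = 0" using False by auto
      then show ?thesis using max_mod_upper[OF hol F0 that] by simp
    qed
    then have q1: "poly (q - 1) z = 0" if "cmod z \<le> 1/4" for z using that expF[of z] by simp
    have "q - 1 = 0"
    proof (rule ccontr)
      assume "q - 1 \<noteq> 0"
      then have "finite {z. poly (q - 1) z = 0}" by (rule poly_roots_finite)
      moreover have "cball 0 (1/4) \<subseteq> {z. poly (q - 1) z = 0}" using q1 by auto
      ultimately have "finite (cball (0::complex) (1/4))" by (rule rev_finite_subset)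
      then have "finite (ball (0::complex) (1/4))" by (rule finite_subset[OF ball_subset_cball])
      then show False using finite_imp_not_open[of "ball (0::complex) (1/4)"] by simp
    qed
    then have "poly q z = 1" for z by simp
    then have p1: "cmod (poly p z) \<le> 1" if "cmod z < 1" for z using le[OF that] by simp
    have "ball 0 1 \<subseteq> lemniscate p"
    proof (rule subsetI, rule ccontr)
      fix z assume z: "z \<in> ball (0::complex) 1" "z \<notin> lemniscate p"
      then have "cmod (poly p z) \<ge> 1" by (simp add: lemniscate_def)
      then have "poly p constant_on ball 0 1"
        proof (intro maximum_modulus_principle[of "poly p" "ball 0 1" "ball 0 1" z])
        show "poly p holomorphic_on ball 0 1" by (intro holomorphic_intros)
        fix u assume "u \<in> ball (0::complex) 1"
        then show "cmod (poly p u) \<le> cmod (poly p z)" using p1[of u] \<open>cmod (poly p z) \<ge> 1\<close> by simp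
      qed (use z in auto)
      then obtain c where c: "\<And>z. z \<in> ball 0 1 \<Longrightarrow> poly p z = c" by (auto simp: constant_on_def)
      have "p - [:c:] \<noteq> 0" using p n by (auto simp: monic_polys_zeros_in_def)
      then have "finite {z. poly (p - [:c:]) z = 0}" by (rule poly_roots_finite)
      moreover have "ball 0 1 \<subseteq> {z. poly (p - [:c:]) z = 0}" using c by auto
      ultimately have "finite (ball (0::complex) 1)" by (rule rev_finite_subset)
      then show False using finite_imp_not_open[of "ball (0::complex) 1"] by simp
    qed
    then have "measure lebesgue (ball (0::complex) 1) \<le> measure lebesgue (lemniscate p)"
      using lm by (intro measure_mono_fmeasurable) auto
    then have "pi \<le> measure lebesgue (lemniscate p)" by (simp add: content_disk)
    moreover have "pi / (2^60 * exp (2^22)) / ln (real n) \<le> pi / 1 / 1"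
      using ln1 by (intro frac_le) (auto intro: order_trans[OF _ mult_mono[of 1 _ 1]])
    ultimately show ?thesis by simp
  next
    case True
    obtain z1 where z1: "cmod z1 = 1/4" "cmod (F z1) = max_mod F (1/4)"
      using max_mod_attained[OF hol F0, of "1/4"] by auto
    define \<mu> where "\<mu> = cmod (F z1)"
    have upper: "cmod (F z) \<le> \<mu>" if "cmod z \<le> 1/4" for z
      using max_mod_upper[OF hol F0 that] z1 by (simp add: \<mu>_def)
    have \<mu>: "\<mu> > 0" using True upper by (metis order.refl order_less_le_trans zero_less_norm_iff)
    have BC: "cmod (F z) \<le> 14 * A" if z: "cmod z = 7/8" and A: "A > 0" "\<And>u. cmod u < 1 \<Longrightarrow> cmod (poly q u) < exp A" for z A
    proof -
      have "cmod (F z) * (1 - cmod (z - 0)) \<le> 2 * A * cmod (z - 0)"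
      proof (rule Borel_Caratheodory[OF hol F0])
        fix u assume "u \<in> ball (0::complex) 1"
        then have u: "cmod u < 1" by simp
        have "exp (Re (F u)) < exp A" using A(2)[OF u] Req[OF u] by simp
        then show "Re (F u) < A" by simp
      qed (use A z in auto)
      then show ?thesis using z by simp
    qed
    have growth: "cmod (F z) \<le> exp (6 * real n) * cmod (F z1)" if z: "cmod z = 7/8" for z
    \<comment> \<open>The bound has to be proportional to \<open>\<mu>\<close>. For small
      \<open>\<mu>\<close>, \<open>q - 1\<close> is of size \<open>\<mu>\<close> on the disc of
      radius 1/4, and its degree allows growth by at most \<open>4^n\<close>; otherwise the trivial
      bound \<open>2^n\<close> for \<open>q\<close> suffices.\<close>
    proof (cases "\<mu> \<le> 1/2")
      case \<mu>2: True
      have d: "cmod (poly (q - 1) u) \<le> 3/2 * \<mu>" if "cmod u \<le> 1/4" for u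
      proof -
        have "cmod (exp (F u) - 1) \<le> 3/2 * cmod (F u)"
          using upper[OF that] \<mu>2 by (intro norm_exp_bounds) simp
        then show ?thesis using upper[OF that] expF[of u] that by simp
      qed
      have dq: "degree (q - 1) \<le> n" using degq by (intro degree_diff_le) auto
      define A where "A = 4^n * (3/2 * \<mu>)"
      have A: "A > 0" using \<mu> by (simp add: A_def)
      have "cmod (poly q u) < exp A" if u: "cmod u < 1" for u
      proof -
        have "cmod (poly (q - 1) u) \<le> A"
          unfolding A_def using d u by (intro poly_growth_outside_disk[OF _ dq]) auto
        moreover have "cmod (poly q u) \<le> cmod (poly (q - 1) u) + 1"
          using norm_triangle_ineq[of "poly (q - 1) u" 1] by simp
        moreover have "1 + A < exp A" using exp_lower_Taylor_quadratic[of A] zero_less_power[OF A, of 2] A by linarith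
        ultimately show ?thesis by linarith
      qed
      from BC[OF z A this] have "cmod (F z) \<le> (21 * 4^n) * \<mu>" by (simp add: A_def mult_ac)
      also have "\<dots> \<le> exp (6 * real n) * \<mu>"
      proof (intro mult_right_mono)
        have e2: "2 \<le> exp (1::real)" using exp_ge_add_one_self[of "1::real"] by simp
        have "(21::real) * 4^n \<le> 2^(3*n) * (2^2)^n"
        proof -
          have "(2::real)^9 \<le> 2^(3*n)" using n by (intro power_increasing) auto
          then show ?thesis by (intro mult_mono) auto
        qed
        also have "\<dots> = 2^(3 * n + 2 * n)" by (simp only: power_add power_mult)
        also have "(2::real)^(3 * n + 2 * n) = 2^(5 * n)" by simp
        also have "\<dots> \<le> exp 1 ^ (5 * n)" using e2 by (intro power_mono) auto
        also have "\<dots> = exp (5 * real n)" by (simp add: exp_of_nat_mult[symmetric])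
        finally show "21 * 4^n \<le> exp (6 * real n)" by (rule order_trans) simp
      qed (use \<mu> in auto)
      finally show ?thesis by (simp add: \<mu>_def)
    next
      case False
      have "cmod (poly q u) < exp (real n)" if u: "cmod u < 1" for u
      proof -
        have "cmod (poly q u) \<le> (\<Prod>i<n. 2)"
          unfolding pq prod_norm[symmetric]
        proof (intro prod_mono conjI norm_ge_zero)
          fix i assume "i \<in> {..<n}"
          then show "cmod (1 - cnj (w i) * u) \<le> 2"
            using lt[OF u, of i] norm_triangle_ineq4[of 1 "cnj (w i) * u"] by simp
        qed
        also have "\<dots> = 2^n" by simp
        also have "\<dots> < exp 1 ^ n" using n0 exp_lower_Taylor_quadratic[of "1::real"] by (intro power_strict_mono) auto
        also have "\<dots> = exp (real n)" by (simp add: exp_of_nat_mult[symmetric])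
        finally show ?thesis .
      qed
      from BC[OF z _ this] have "cmod (F z) \<le> 14 * real n" using n0 by simp
      also have "\<dots> \<le> (28 * real n) * \<mu>" using False mult_left_mono[of 1 "2 * \<mu>" "14 * real n"] by simp
      also have "\<dots> \<le> exp (6 * real n) * \<mu>"
      proof (intro mult_right_mono)
        have "real n * 3 \<le> real n * real n" using n by (intro mult_left_mono) auto
        then have "28 * real n \<le> (1 + 3 * real n) ^ 2"
          by (simp add: power2_eq_square algebra_simps)
        also have "\<dots> \<le> exp (3 * real n) ^ 2" by (intro power_mono) auto
        also have "\<dots> = exp (6 * real n)" by (simp add: power2_eq_square exp_add[symmetric])
        finally show "28 * real n \<le> exp (6 * real n)" .
      qed (use \<mu> in auto)
      finally show ?thesis by (simp add: \<mu>_def)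
    qed
    have "pi / (2^60 * exp (2^22)) / ln (real n) \<le> measure lebesgue (neg_set F)"
      using n \<mu> z1 growth by (intro negative_area_lower_bound[OF hol F0]) (auto simp: \<mu>_def)
    also have "\<dots> \<le> measure lebesgue (lemniscate p)"
    proof (intro measure_mono_fmeasurable lm)
      show "neg_set F \<subseteq> lemniscate p"
      proof
        fix z assume "z \<in> neg_set F"
        then have z: "cmod z < 1" "Re (F z) < 0" by auto
        have "cmod (poly p z) \<le> exp (Re (F z))" using le[OF z(1)] Req[OF z(1)] by simp
        also have "\<dots> < 1" using z(2) by simp
        finally show "z \<in> lemniscate p" by (simp add: lemniscate_def)
      qed
      show "neg_set F \<in> sets lebesgue" using negative_set_lmeasurable[OF hol F0] by auto
    qed
    finally show ?thesis .
  qed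
qed

section \<open>Polynomials with small lemniscates\<close>

text \<open>If \<open>w\<close> is the value at \<open>z\<close> of a polynomial approximating \<open>1 / (z - b)\<close>, then \<open>b + 1 / w\<close> is an
  approximation of \<open>z\<close>. Passing from \<open>w\<close> to \<open>w * (\<Sum>i<d. (-h * w)^i)\<close>, a truncation of \<open>w / (1 + h * w)\<close>,
  moves the pole from \<open>b\<close> to \<open>b - h\<close>, and it moves the approximation of \<open>z\<close> by only \<open>O(2^-d)\<close>; the errors
  therefore add up instead of being multiplied.\<close>

lemma pole_pushing_step:
  fixes w z :: complex and b h e :: real
  assumes h: "0 < h" "h \<le> 1/12" and w: "w \<noteq> 0" and e: "cmod (of_real b + 1 / w - z) \<le> e" "e \<le> h"
    and far: "4 * h \<le> cmod (z - of_real b)" and z: "cmod z \<le> 1" and b: "0 \<le> b - h" "b \<le> 2" and d: "d \<ge> 1"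
  defines "w' \<equiv> w * (\<Sum>i<d. (- of_real h * w)^i)"
  shows "w' \<noteq> 0" "cmod (of_real (b - h) + 1 / w' - z) \<le> e + 10 / 2^d"
proof -
  define \<rho> where "\<rho> = - of_real h * w"
  have "cmod (z - of_real b) \<le> cmod (1 / w) + cmod (of_real b + 1 / w - z)"
    using norm_triangle_ineq4[of "1 / w" "of_real b + 1 / w - z"] by simp
  \<comment> \<open>Distance \<open>4 * h\<close> from the pole, less an error of at most
    \<open>h\<close>; this makes the ratio \<open>\<rho>\<close> of the geometric sum at most
    1/3.\<close>
  then have "3 * h \<le> 1 / cmod w" using e far by (simp add: norm_divide)
  then have "cmod \<rho> \<le> 1/3" using w h by (simp add: \<rho>_def norm_mult field_simps)
  then have \<rho>: "cmod \<rho> \<le> 1/2" by simp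
  have "cmod (\<rho>^d) \<le> (1/2)^d" unfolding norm_power using \<rho> by (intro power_mono) auto
  then have \<rho>d: "cmod (\<rho>^d) \<le> 1 / 2^d" by (simp add: power_divide)
  also have "(1::real) / 2^d \<le> 1 / 2^1" using d by (intro divide_left_mono power_increasing) auto
  finally have \<rho>d2: "cmod (\<rho>^d) \<le> 1/2" by simp
  have n1: "1/2 \<le> cmod (1 - \<rho>^d)" using norm_triangle_ineq2[of 1 "\<rho>^d"] \<rho>d2 by simp
  then have nz1: "1 - \<rho>^d \<noteq> 0" by auto
  have nz2: "1 - \<rho> \<noteq> 0" using norm_triangle_ineq2[of 1 \<rho>] \<rho> by auto
  have w': "w' = w * ((1 - \<rho>^d) / (1 - \<rho>))"
    using nz2 unfolding w'_def \<rho>_def[symmetric] by (simp add: sum_gp_strict)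
  then show "w' \<noteq> 0" using w nz1 nz2 by simp
  have inv: "1 / w' = (1 / w + of_real h) / (1 - \<rho>^d)"
    using w nz1 nz2 by (simp add: w' \<rho>_def field_simps)
  \<comment> \<open>The untruncated series would shift \<open>1 / w\<close> by exactly
    \<open>h\<close>; the old error survives unamplified and only the term with
    \<open>\<rho>^d\<close> is new.\<close>
  have eq: "of_real (b - h) + 1 / w' - z = (of_real b + 1 / w - z) + (1 / w + of_real h) * \<rho>^d / (1 - \<rho>^d)"
  proof -
    have "x / (1 - \<rho>^d) = x + x * \<rho>^d / (1 - \<rho>^d)" for x
      using nz1 by (simp add: field_simps)
    from this[of "1 / w + of_real h"] show ?thesis unfolding inv by simp
  qed
  have bd: "cmod ((1 / w + of_real h) * \<rho>^d / (1 - \<rho>^d)) \<le> 10 / 2^d"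
  proof -
    have eq: "1 / w + of_real h = (of_real b + 1 / w - z) + (z - of_real (b - h))" by simp
    have "cmod (z - of_real (b - h)) \<le> 1 + (b - h)"
      using norm_triangle_ineq4[of z "of_real (b - h)"] z b by (simp del: of_real_diff)
    then have "cmod (1 / w + of_real h) \<le> e + 1 + (b - h)"
      unfolding eq using norm_triangle_ineq[of "of_real b + 1 / w - z" "z - of_real (b - h)"] e by linarith
    also have "\<dots> \<le> 4" using e h b by simp
    finally have "cmod ((1 / w + of_real h) * \<rho>^d / (1 - \<rho>^d)) \<le> 4 * (1 / 2^d) / (1/2)"
      unfolding norm_divide norm_mult using \<rho>d n1 by (intro frac_le mult_mono) auto
    also have "\<dots> \<le> 10 / 2^d" by (simp add: field_simps)
    finally show ?thesis .
  qed
  show "cmod (of_real (b - h) + 1 / w' - z) \<le> e + 10 / 2^d"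
    unfolding eq by (rule order_trans[OF norm_triangle_ineq add_mono[OF e(1) bd]])
qed

text \<open>Induction from the truncated Taylor series of \<open>1 / (z - 2)\<close>, composing with
  one geometric sum per step. The points \<open>z = 0\<close> and those with
  \<open>11 * h \<le> \<bar>Im z\<bar>\<close> stay at distance \<open>4 * h\<close> from every pole
  that still has to move; at the remaining points of the disc only the crude modulus bound is
  carried along.\<close>

lemma pole_pushing:
  fixes k d t :: nat
  assumes k: "k \<ge> 12" and d: "20 * k^2 \<le> 2^d" and t: "t + 4 \<le> 2 * k"
  defines "h \<equiv> 1 / real k"
  shows "\<exists>Q. degree Q \<le> d^(t+1) \<and> (\<forall>z. poly Q (cnj z) = cnj (poly Q z)) \<and>
     (\<forall>z. cmod z \<le> 1 \<longrightarrow> cmod (poly Q z) \<le> real d ^ ((2*d)^t)) \<and>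
     (\<forall>z. cmod z \<le> 1 \<longrightarrow> z = 0 \<or> 11 * h \<le> \<bar>Im z\<bar> \<longrightarrow>
        poly Q z \<noteq> 0 \<and> cmod (of_real (2 - real t * h) + 1 / poly Q z - z) \<le> real (t+1) * (10 / 2^d))"
  using t
proof (induction t)
  have "12^2 \<le> k^2" using k by (intro power_mono) auto
  then have "d \<noteq> 0" using d by (intro notI) simp
  then have d1: "d \<ge> 1" by simp
  {
    case 0
    define Q :: "complex poly" where "Q = (\<Sum>i<d. monom (- ((1/2)^(i+1))) i)"
    have Q: "poly Q z = - (1/2) * (\<Sum>i<d. (z/2)^i)" for z
      by (simp add: Q_def poly_sum poly_monom sum_distrib_left power_divide)
    have deg: "degree Q \<le> d"
      unfolding Q_def by (intro degree_sum_le) (auto intro: order_trans[OF degree_monom_le])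
    have bd: "cmod (poly Q z) \<le> real d ^ 1" if z: "cmod z \<le> 1" for z
    proof -
      have "cmod (\<Sum>i<d. (z/2)^i) \<le> (\<Sum>i<d. 1)"
        using z by (intro order_trans[OF norm_sum] sum_mono) (auto simp: norm_power norm_divide intro!: power_le_one)
      then show ?thesis by (simp add: Q norm_mult)
    qed
    have ap: "poly Q z \<noteq> 0 \<and> cmod (2 + 1 / poly Q z - z) \<le> 10 / 2^d" if z: "cmod z \<le> 1" for z
    proof -
      define x where "x = z / 2"
      have x: "cmod x \<le> 1/2" using z by (simp add: x_def norm_divide)
      have "cmod (x^d) \<le> (1/2)^d" unfolding norm_power using x by (intro power_mono) auto
      then have xd: "cmod (x^d) \<le> 1 / 2^d" by (simp add: power_divide)
      also have "(1::real) / 2^d \<le> 1 / 2^1" using d1 by (intro divide_left_mono power_increasing) auto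
      finally have n1: "1/2 \<le> cmod (1 - x^d)" using norm_triangle_ineq2[of 1 "x^d"] by simp
      then have nz1: "1 - x^d \<noteq> 0" by auto
      have nz2: "1 - x \<noteq> 0" using norm_triangle_ineq2[of 1 x] x by auto
      have Qz: "poly Q z = - (1/2) * ((1 - x^d) / (1 - x))"
        using nz2 sum_gp_strict[of x d] by (simp add: Q x_def)
      have "2 + 1 / poly Q z - z = (z - 2) * x^d / (1 - x^d)"
        using nz1 nz2 unfolding Qz by (simp add: x_def field_simps)
      moreover have "cmod ((z - 2) * x^d / (1 - x^d)) \<le> 3 * (1 / 2^d) / (1/2)"
        unfolding norm_divide norm_mult using xd n1 z norm_triangle_ineq4[of z 2] by (intro frac_le mult_mono) auto
      moreover have "3 * (1 / 2^d) / (1/2) \<le> (10 / 2^d :: real)" by (simp add: field_simps)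
      ultimately show ?thesis using nz1 nz2 by (simp add: Qz)
    qed
    show ?case
      by (rule exI[of _ Q]) (use deg bd ap in \<open>auto simp: Q cnj_sum\<close>)
  next
    case (Suc t)
    then have "t + 4 \<le> 2 * k" by simp
    from Suc.IH[OF this] obtain Q where Q: "degree Q \<le> d^(t+1)" "\<And>z. poly Q (cnj z) = cnj (poly Q z)"
       "\<And>z. cmod z \<le> 1 \<Longrightarrow> cmod (poly Q z) \<le> real d ^ ((2*d)^t)"
       "\<And>z. cmod z \<le> 1 \<Longrightarrow> z = 0 \<or> 11 * h \<le> \<bar>Im z\<bar> \<Longrightarrow>
          poly Q z \<noteq> 0 \<and> cmod (of_real (2 - real t * h) + 1 / poly Q z - z) \<le> real (t+1) * (10 / 2^d)"
      by blast
    have h: "0 < h" "h \<le> 1/12" using k by (auto simp: h_def field_simps)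
    define S :: "complex poly" where "S = (\<Sum>i<d. monom ((- of_real h)^i) (i+1))"
    have S: "poly S w = w * (\<Sum>i<d. (- of_real h * w)^i)" for w
      by (simp add: S_def poly_sum poly_monom sum_distrib_left power_mult_distrib[symmetric] mult_ac)
    have degS: "degree S \<le> d"
      unfolding S_def by (intro degree_sum_le) (auto intro!: order_trans[OF degree_monom_le])
    define R where "R = pcompose S Q"
    have R: "poly R z = poly Q z * (\<Sum>i<d. (- of_real h * poly Q z)^i)" for z
      by (simp add: R_def poly_pcompose S)
    have "degree R \<le> d * d^(t+1)"
      unfolding R_def by (rule order_trans[OF degree_pcompose_le]) (intro mult_mono degS Q(1); simp)
    moreover have "poly R (cnj z) = cnj (poly R z)" for z
      by (simp add: R Q(2) cnj_sum)
    moreover have "cmod (poly R z) \<le> real d ^ ((2*d)^(Suc t))" if z: "cmod z \<le> 1" for z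
    proof -
      define B where "B = real d ^ ((2*d)^t)"
      have B1: "B \<ge> 1" unfolding B_def using d1 by (intro one_le_power) auto
      have wB: "cmod (poly Q z) \<le> B" using Q(3)[OF z] by (simp add: B_def)
      have "cmod (\<Sum>i<d. (- of_real h * poly Q z)^i) \<le> (\<Sum>i<d. B^(d-1))"
      proof (intro order_trans[OF norm_sum] sum_mono)
        fix i assume i: "i \<in> {..<d}"
        have "cmod (- of_real h * poly Q z) \<le> 1 * B"
          unfolding norm_mult using h wB by (intro mult_mono) auto
        then have "cmod ((- of_real h * poly Q z)^i) \<le> B^i" unfolding norm_power by (intro power_mono) auto
        also have "\<dots> \<le> B^(d-1)" using B1 i by (intro power_increasing) auto
        finally show "cmod ((- of_real h * poly Q z)^i) \<le> B^(d-1)" .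
      qed
      then have "cmod (poly R z) \<le> B * (real d * B^(d-1))"
        unfolding R norm_mult using wB B1 by (intro mult_mono) auto
      also have "\<dots> = real d * B^d" using d1 by (cases d) auto
      also have "\<dots> = real d ^ (1 + (2*d)^t * d)" by (simp add: B_def power_mult)
      also have "\<dots> \<le> real d ^ ((2*d)^(Suc t))"
      proof (intro power_increasing)
        have "1 \<le> (2*d)^t * d" using d1 by simp
        then show "1 + (2*d)^t * d \<le> (2*d)^(Suc t)" by simp
      qed (use d1 in auto)
      finally show ?thesis .
    qed
    moreover have "poly R z \<noteq> 0 \<and> cmod (of_real (2 - real (Suc t) * h) + 1 / poly R z - z) \<le> real (Suc t + 1) * (10 / 2^d)"
      if z: "cmod z \<le> 1" "z = 0 \<or> 11 * h \<le> \<bar>Im z\<bar>" for z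
    proof -
      define b where "b = 2 - real t * h"
      have kh: "real k * h = 1" using k by (simp add: h_def)
      have tk: "real t + 5 \<le> 2 * real k" using Suc.prems by linarith
      have th: "(real t + 5) * h \<le> 2"
        using mult_right_mono[OF tk, of h] h kh by (simp add: mult.assoc)
      have b5: "5 * h \<le> b" "b \<le> 2" using th h by (auto simp: b_def algebra_simps)
      have far: "4 * h \<le> cmod (z - of_real b)"
        using z(2)
      proof
        assume "z = 0" then show ?thesis using b5 h by simp
      next
        assume "11 * h \<le> \<bar>Im z\<bar>" then show ?thesis using abs_Im_le_cmod[of "z - of_real b"] h by simp
      qed
      \<comment> \<open>The assumption \<open>20 * k^2 \<le> 2^d\<close> keeps the errors of fewer
        than \<open>2 * k\<close> truncations below \<open>h\<close> in total.\<close>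
      have small: "real (t+1) * (10 / 2^d) \<le> h"
      proof -
        have "real (20 * k^2) \<le> real (2^d)" using d by (rule of_nat_mono)
        then have "20 * (real k)^2 \<le> 2^d" by simp
        then have "(2 * real k) * 10 * real k \<le> 2^d" by (simp add: power2_eq_square)
        moreover have "real (t+1) * 10 * real k \<le> (2 * real k) * 10 * real k"
          using tk by (intro mult_right_mono) auto
        ultimately have "real (t+1) * 10 * real k \<le> 2^d" by linarith
        then show ?thesis using k by (simp add: h_def field_simps)
      qed
      note st = pole_pushing_step[OF h conjunct1[OF Q(4)[OF z]] conjunct2[OF Q(4)[OF z], folded b_def] small far z(1) _ b5(2) d1]
      have b0: "0 \<le> b - h" using b5 h by simp
      have e1: "2 - real (Suc t) * h = b - h" by (simp add: b_def algebra_simps)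
      have e2: "real (Suc t + 1) * (10 / 2^d) = real (t+1) * (10 / 2^d) + 10 / 2^d"
        by (simp add: add_divide_distrib[symmetric] algebra_simps)
      show ?thesis using st[OF b0] unfolding R[symmetric] e1 e2 by simp
    qed
    ultimately show ?case by (intro exI[of _ R]) auto
  }
qed

text \<open>\<open>A\<close> and its reflection have equal modulus on the unit circle, by the
  conjugation symmetry of \<open>A\<close>. As \<open>A\<close> has no zero in the closed disc, the
  maximum principle makes the reflection the smaller one inside. The normalisation
  \<open>poly A 0 = 1\<close> makes \<open>p\<close> monic of the stated degree.\<close>

lemma self_inversive_polynomial:
  fixes A :: "complex poly" and N :: nat
  assumes A0: "poly A 0 = 1" and real: "\<And>z. poly A (cnj z) = cnj (poly A z)"
    and A: "\<And>z. cmod z \<le> 1 \<Longrightarrow> 1/2 \<le> cmod (poly A z)" and N: "N \<ge> 1"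
  defines "p \<equiv> A + monom 1 N * reflect_poly A"
  shows "p \<in> monic_polys_zeros_in (N + degree A) (cball 0 1)"
    and "\<And>z. cmod z \<le> 1 \<Longrightarrow> cmod (poly A z) * (1 - cmod z ^ N) \<le> cmod (poly p z)"
    and "\<And>z. z \<noteq> 0 \<Longrightarrow> cmod (poly p z) = cmod z ^ (N + degree A) * cmod (poly p (inverse z))"
proof -
  define m where "m = degree A"
  have c0: "coeff A 0 = 1" using A0 by (simp add: poly_0_coeff_0)
  have Anz: "poly A z \<noteq> 0" if "cmod z \<le> 1" for z using A[OF that] by auto
  have refl: "poly (reflect_poly A) z = z^m * poly A (inverse z)" if "z \<noteq> 0" for z
    using poly_reflect_poly_nz[OF that] by (simp add: m_def)
  have pz: "poly p z = poly A z + z^N * poly (reflect_poly A) z" for z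
    by (simp add: p_def poly_monom)
  have circ: "cmod (poly (reflect_poly A) z) = cmod (poly A z)" if z: "cmod z = 1" for z
  proof -
    have z0: "z \<noteq> 0" using z by auto
    have "inverse z = cnj z" by (rule inverse_unique) (simp add: complex_norm_square[symmetric] z)
    then show ?thesis using refl[OF z0] z by (simp add: real norm_mult norm_power)
  qed
  have le: "cmod (poly (reflect_poly A) z) \<le> cmod (poly A z)" if z: "cmod z \<le> 1" for z
  proof -
    have "cmod (poly (reflect_poly A) z / poly A z) \<le> 1"
    proof (rule maximum_modulus_frontier[of "\<lambda>z. poly (reflect_poly A) z / poly A z" "cball 0 1"])
      show "(\<lambda>z. poly (reflect_poly A) z / poly A z) holomorphic_on interior (cball 0 1)"
        using Anz by (intro holomorphic_intros) (auto simp: interior_cball)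
      show "continuous_on (closure (cball 0 1)) (\<lambda>z. poly (reflect_poly A) z / poly A z)"
        using Anz by (intro continuous_intros) auto
      show "cmod (poly (reflect_poly A) w / poly A w) \<le> 1" if "w \<in> frontier (cball 0 1)" for w
        using that circ[of w] by (simp add: norm_divide dist_norm)
    qed (use z in auto)
    then show ?thesis using Anz[OF z] by (simp add: norm_divide field_simps)
  qed
  show lower: "cmod (poly A z) * (1 - cmod z ^ N) \<le> cmod (poly p z)" if z: "cmod z \<le> 1" for z
  proof -
    have "cmod (z^N * poly (reflect_poly A) z) \<le> cmod z ^ N * cmod (poly A z)"
      unfolding norm_mult norm_power using le[OF z] by (intro mult_left_mono) auto
    then show ?thesis
      using norm_triangle_ineq2[of "poly A z" "- (z^N * poly (reflect_poly A) z)"] unfolding pz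
      by (simp add: algebra_simps)
  qed
  show inv: "cmod (poly p z) = cmod z ^ (N + degree A) * cmod (poly p (inverse z))" if z: "z \<noteq> 0" for z
  proof -
    have iz: "inverse z \<noteq> 0" using z by simp
    have "z ^ (N + m) * poly p (inverse z) = poly p z"
      unfolding pz refl[OF z] refl[OF iz] using z
      by (simp add: power_add field_simps)
    then show ?thesis by (metis m_def norm_mult norm_power)
  qed
  \<comment> \<open>A zero outside the closed disc would be reflected to one in the open disc, which
    the lower bound excludes.\<close>
  have "poly p z \<noteq> 0" if z: "cmod z > 1" for z
  proof
    assume 0: "poly p z = 0"
    have z0: "z \<noteq> 0" using z by auto
    define u where "u = inverse z"
    have u: "cmod u < 1" using z by (simp add: u_def norm_inverse inverse_less_1_iff)
    have "cmod (poly p u) = 0" using inv[OF z0] 0 z0 by (simp add: u_def)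
    then have "cmod (poly A u) * (1 - cmod u ^ N) \<le> 0" using lower[of u] u by simp
    moreover have "cmod u ^ N < 1" using u N by (intro power_less_one_iff[THEN iffD2]) auto
    then have "0 < cmod (poly A u) * (1 - cmod u ^ N)" using A[of u] u by (intro mult_pos_pos) auto
    ultimately show False by linarith
  qed
  then have zeros: "\<forall>z. poly p z = 0 \<longrightarrow> z \<in> cball 0 1" by (metis mem_cball_0 not_le)
  have A_0: "A \<noteq> 0" using A0 by auto
  have degR: "degree (reflect_poly A) = m" using c0 by (simp add: m_def)
  have degM: "degree (monom 1 N * reflect_poly A) = N + m"
    using A_0 degR by (subst degree_mult_eq) (auto simp: degree_monom_eq)
  have lt: "degree A < degree (monom 1 N * reflect_poly A)" using degM N by (simp add: m_def)
  have "degree p = N + m" unfolding p_def using degree_add_eq_right[OF lt] degM by simp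
  moreover have "lead_coeff p = 1"
    unfolding p_def lead_coeff_add_le[OF lt]
    using c0 by (simp add: lead_coeff_mult lead_coeff_monom coeff_reflect_poly degree_monom_eq)
  ultimately show "p \<in> monic_polys_zeros_in (N + degree A) (cball 0 1)"
    using zeros by (simp add: monic_polys_zeros_in_def m_def)
qed

text \<open>The rectangle contributes \<open>4 * 22 * h = 88 * h\<close> and the annulus at most
  \<open>32 * h\<close>.\<close>

lemma measure_strip_and_annulus:
  fixes h :: real
  assumes h: "0 < h" "h \<le> 1/12"
    and S: "S \<in> lmeasurable" "S \<subseteq> cbox (Complex (-2) (-11*h)) (Complex 2 (11*h)) \<union> (ball 0 (1+2*h) - ball 0 (1-h))"
  shows "measure lebesgue S \<le> 120 * h"
proof -
  let ?R = "cbox (Complex (-2) (-11*h)) (Complex 2 (11*h))" and ?A = "ball (0::complex) (1+2*h) - ball 0 (1-h)"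
  have A: "?A \<in> lmeasurable" by (intro fmeasurable_Diff) auto
  have "measure lebesgue ?R = (2 - -2) * (11*h - - (11*h))"
    using h by (subst measure_completion, simp, subst content_cbox)
      (auto simp: Basis_complex_def inner_complex_def complex_eq_iff)
  then have mR: "measure lebesgue ?R = 88 * h" by simp
  have "measure lebesgue ?A = measure lebesgue (ball (0::complex) (1+2*h)) - measure lebesgue (ball (0::complex) (1-h))"
    using h by (intro measurable_measure_Diff) auto
  also have "\<dots> = pi * (1+2*h)^2 - pi * (1-h)^2" using h by (simp add: content_disk)
  also have "\<dots> = pi * (h * (6 + 3 * h))" by (simp add: power2_eq_square algebra_simps)
  also have "\<dots> \<le> 4 * (h * 8)" using pi_less_4 h by (intro mult_mono) auto
  finally have mA: "measure lebesgue ?A \<le> 32 * h" by simp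
  have "measure lebesgue S \<le> measure lebesgue (?R \<union> ?A)"
    using S A by (intro measure_mono_fmeasurable) auto
  also have "\<dots> \<le> measure lebesgue ?R + measure lebesgue ?A" using A by (intro measure_Un_le) auto
  finally show ?thesis using mR mA by linarith
qed

text \<open>After \<open>2 * k - 4\<close> steps the pole is at \<open>4 * h\<close>. Hence
  \<open>cmod (poly Q 0) \<ge> 1 / (5 * h)\<close>, while
  \<open>cmod (poly Q z) \<le> 1 / (10 * h)\<close> off the strip, and \<open>A\<close> exceeds 1
  there by a fixed fraction of \<open>\<kappa>\<close>. The lemniscate is left with the strip and an
  annulus of width \<open>3 * h\<close>.\<close>

lemma small_lemniscate_exists:
  fixes k n :: nat
  assumes k: "k \<ge> 12" and pow: "20 * k^2 \<le> 2^k" and n: "(2*k)^(2*k) \<le> n"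
  shows "\<exists>p \<in> monic_polys_zeros_in n (cball 0 1). measure lebesgue (lemniscate p) \<le> 120 / real k"
proof -
  define h where "h = 1 / real k"
  have h: "0 < h" "h \<le> 1/12" using k by (auto simp: h_def field_simps)
  define t where "t = 2 * k - 4"
  have t: "t + 4 \<le> 2 * k" using k by (simp add: t_def)
  have b: "2 - real t * h = 4 * h" using k by (simp add: t_def h_def of_nat_diff field_simps)
  have smallerr: "real (t+1) * (10 / 2^k) \<le> h"
  proof -
    have "real (20 * k^2) \<le> real (2^k)" using pow by (rule of_nat_mono)
    then have "(2 * real k) * 10 * real k \<le> 2^k" by (simp add: power2_eq_square)
    moreover have "real (t+1) * 10 * real k \<le> (2 * real k) * 10 * real k"
      using t by (intro mult_right_mono) auto
    ultimately have "real (t+1) * 10 * real k \<le> 2^k" by linarith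
    then show ?thesis using k by (simp add: h_def field_simps)
  qed
  define B where "B = real k ^ ((2*k)^t)"
  obtain Q where Q: "degree Q \<le> k^(t+1)" "\<And>z. poly Q (cnj z) = cnj (poly Q z)"
     "\<And>z. cmod z \<le> 1 \<Longrightarrow> cmod (poly Q z) \<le> B"
     "\<And>z. cmod z \<le> 1 \<Longrightarrow> z = 0 \<or> 11 * h \<le> \<bar>Im z\<bar> \<Longrightarrow>
        poly Q z \<noteq> 0 \<and> cmod (of_real (4 * h) + 1 / poly Q z - z) \<le> real (t+1) * (10 / 2^k)"
    using pole_pushing[OF k pow t] unfolding h_def[symmetric] b B_def by blast
  have B1: "B \<ge> 1" unfolding B_def using k by (intro one_le_power) auto
  define q0 where "q0 = poly Q 0"
  have q0nz: "q0 \<noteq> 0" using Q(4)[of 0] by (simp add: q0_def)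
  have q0: "1 / (5 * h) \<le> cmod q0"
  proof -
    have "cmod (of_real (4 * h) + 1 / q0 - 0) \<le> h" using Q(4)[of 0] smallerr unfolding q0_def by (metis norm_zero order_trans zero_le_one)
    then have "cmod (1 / q0) \<le> h + 4 * h"
      using norm_triangle_ineq4[of "of_real (4 * h) + 1 / q0" "of_real (4 * h)"] h by simp
    then show ?thesis using h q0nz by (simp add: norm_divide field_simps)
  qed
  have q0real: "cnj q0 = q0" using Q(2)[of 0] by (simp add: q0_def)
  have Qsmall: "cmod (poly Q z) \<le> 1 / (10 * h)" if z: "cmod z \<le> 1" "11 * h \<le> \<bar>Im z\<bar>" for z
  proof -
    have nz: "poly Q z \<noteq> 0" and ap: "cmod (of_real (4 * h) + 1 / poly Q z - z) \<le> h"
      using Q(4)[of z] z smallerr by auto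
    have "\<bar>Im (of_real (4 * h) + 1 / poly Q z - z)\<bar> \<le> h" using ap abs_Im_le_cmod order_trans by blast
    then have "10 * h \<le> \<bar>Im (1 / poly Q z)\<bar>" using z(2) by simp
    also have "\<dots> \<le> cmod (1 / poly Q z)" by (rule abs_Im_le_cmod)
    finally have "10 * h \<le> 1 / cmod (poly Q z)" by (simp add: norm_divide)
    then show ?thesis using nz h by (simp add: field_simps)
  qed
  \<comment> \<open>Small enough that \<open>A\<close> stays at least 1/2 in modulus even inside the
    strip, where \<open>Q\<close> is only known to be bounded by \<open>B\<close>.\<close>
  define \<kappa> where "\<kappa> = 1 / (4 * B)"
  have \<kappa>: "0 < \<kappa>" "\<kappa> \<le> 1/4" using B1 by (auto simp: \<kappa>_def field_simps)
  define A where "A = [:1 + of_real \<kappa>:] - smult (of_real \<kappa> / q0) Q"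
  have Az: "poly A z = 1 + of_real \<kappa> * (1 - poly Q z / q0)" for z by (simp add: A_def algebra_simps)
  have A0: "poly A 0 = 1" using q0nz by (simp add: Az q0_def)
  have Areal: "poly A (cnj z) = cnj (poly A z)" for z by (simp add: Az Q(2) q0real)
  have Ahalf: "1/2 \<le> cmod (poly A z)" if z: "cmod z \<le> 1" for z
  proof -
    have "cmod (poly Q z / q0) \<le> B / (1 / (5 * h))"
      unfolding norm_divide using Q(3)[OF z] q0 h B1 by (intro frac_le) auto
    also have "\<dots> = 5 * h * B" by simp
    also have "\<dots> \<le> 1 * B" using h B1 by (intro mult_right_mono) auto
    finally have "cmod (1 - poly Q z / q0) \<le> 2 * B" using norm_triangle_ineq4[of 1 "poly Q z / q0"] B1 by simp
    then have "cmod (of_real \<kappa> * (1 - poly Q z / q0)) \<le> \<kappa> * (2 * B)"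
      unfolding norm_mult using \<kappa> by (intro mult_mono) auto
    also have "\<dots> = 1/2" using B1 by (simp add: \<kappa>_def)
    finally show ?thesis unfolding Az using norm_triangle_ineq2[of 1 "- (of_real \<kappa> * (1 - poly Q z / q0))"] by simp
  qed
  have Abig: "1 + \<kappa>/2 \<le> cmod (poly A z)" if z: "cmod z \<le> 1" "11 * h \<le> \<bar>Im z\<bar>" for z
  proof -
    have "cmod (poly Q z / q0) \<le> (1 / (10 * h)) / (1 / (5 * h))"
      unfolding norm_divide using Qsmall[OF z] q0 h by (intro frac_le) auto
    also have "\<dots> = 1/2" using h by simp
    finally have "Re (poly Q z / q0) \<le> 1/2" using complex_Re_le_cmod order_trans by blast
    then have "\<kappa> * (1/2) \<le> \<kappa> * Re (1 - poly Q z / q0)" using \<kappa> by (intro mult_left_mono) auto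
    then have "1 + \<kappa>/2 \<le> Re (poly A z)" by (simp add: Az)
    then show ?thesis using complex_Re_le_cmod order_trans by blast
  qed
  have degA: "degree A \<le> k^(t+1)"
    unfolding A_def using Q(1) by (intro degree_diff_le order_trans[OF degree_smult_le]) auto
  \<comment> \<open>The degree left over for the power. It must make \<open>(1 - h)^N\<close> small
    compared with \<open>\<kappa> = 1 / (4 * B)\<close>, and this is what forces \<open>n\<close> to
    be as large as \<open>(2*k)^(2*k)\<close>.\<close>
  define N where "N = n - degree A"
  have Nbig: "k * (3 + k * (2*k)^t) \<le> N" and degn: "degree A < n"
  proof -
    define x where "x = (2*k)^t"
    have x1: "x \<ge> 1" using k by (simp add: x_def)
    have kt: "k^(t+1) \<le> k * x" unfolding x_def by (simp add: power_mono)
    have "(2*k)^(2*k) = (2*k)^(t + 4)" using k by (simp add: t_def)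
    also have "\<dots> = (2*k)^4 * x" by (simp add: power_add x_def)
    finally have e: "(2*k)^(2*k) = (2*k)^4 * x" .
    have k4: "k + 3 * k + k * k < (2*k)^4"
    proof -
      have "12 * k \<le> k * k" using k by (rule mult_le_mono1)
      then have "k + 3 * k + k * k \<le> k * k + k * k + k * k" by linarith
      also have "\<dots> < 16 * (k * k) * 1" using k by simp
      also have "\<dots> \<le> 16 * (k * k) * (k * k)" using k by (intro mult_left_mono) auto
      also have "\<dots> = (2*k)^4" by (simp add: power4_eq_xxxx)
      finally show ?thesis .
    qed
    have "degree A + k * (3 + k * x) \<le> k * x + (3 * k * x + k * k * x)"
    proof -
      have "3 * k * 1 \<le> 3 * k * x" using x1 by (rule mult_le_mono2)
      moreover have "k * (3 + k * x) = 3 * k + k * k * x" by (simp add: algebra_simps)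
      ultimately show ?thesis using degA kt by linarith
    qed
    also have "\<dots> = (k + 3 * k + k * k) * x" by (simp add: algebra_simps)
    also have "\<dots> < (2*k)^4 * x" using k4 x1 by simp
    also have "\<dots> \<le> n" using n e by simp
    finally have "degree A + k * (3 + k * x) < n" .
    then show "k * (3 + k * (2*k)^t) \<le> N" "degree A < n" by (auto simp: N_def x_def)
  qed
  have N1: "N \<ge> 1" and NA: "N + degree A = n" using degn by (auto simp: N_def)
  define p where "p = A + monom 1 N * reflect_poly A"
  have SI1: "p \<in> monic_polys_zeros_in n (cball 0 1)"
    unfolding p_def NA[symmetric] by (rule self_inversive_polynomial(1)) (use A0 Areal Ahalf N1 in auto)
  have SI2: "cmod (poly A z) * (1 - cmod z ^ N) \<le> cmod (poly p z)" if "cmod z \<le> 1" for z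
    unfolding p_def by (rule self_inversive_polynomial(2)) (use A0 Areal Ahalf N1 that in auto)
  have SI3: "cmod (poly p z) = cmod z ^ n * cmod (poly p (inverse z))" if "z \<noteq> 0" for z
    unfolding p_def NA[symmetric] by (rule self_inversive_polynomial(3)) (use A0 Areal Ahalf N1 that in auto)
  have decay: "(1 - h)^N \<le> \<kappa> / 4"
  proof -
    have "(1 - h)^N \<le> exp (- h)^N" using exp_ge_add_one_self[of "- h"] h by (intro power_mono) auto
    also have "\<dots> = exp (- (h * real N))" by (simp add: exp_of_nat_mult[symmetric] mult.commute)
    also have "\<dots> \<le> exp (- (3 + real k * (2*real k)^t))"
    proof -
      have "real (k * (3 + k * (2*k)^t)) \<le> real N" using Nbig by (rule of_nat_mono)
      then have "h * (real k * (3 + real k * (2*real k)^t)) \<le> h * real N" using h by (intro mult_left_mono) auto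
      then show ?thesis using k by (simp add: h_def)
    qed
    also have "\<dots> \<le> 1 / (16 * B)"
    proof -
      have e3: "(16::real) \<le> exp 3"
      proof -
        have "inverse (2^32) \<le> (1/100 :: real)" by simp
        then have "8/3 \<le> exp (1::real)" using e_approx_32 by linarith
        then have "(8/3)^3 \<le> exp (1::real) ^ 3" by (intro power_mono) auto
        also have "exp (1::real) ^ 3 = exp 3" by (simp add: exp_of_nat_mult[symmetric])
        finally show ?thesis by (simp add: power3_eq_cube)
      qed
      have "B \<le> exp (real k) ^ ((2*k)^t)" unfolding B_def
        using exp_ge_add_one_self[of "real k"] by (intro power_mono) linarith+
      also have "\<dots> = exp (real k * (2 * real k)^t)" by (simp add: exp_of_nat_mult[symmetric] mult.commute)
      finally have "16 * B \<le> exp 3 * exp (real k * (2 * real k)^t)" using e3 B1 by (intro mult_mono) auto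
      also have "\<dots> = exp (3 + real k * (2 * real k)^t)" by (simp add: exp_add)
      finally have "16 * B \<le> exp (3 + real k * (2 * real k)^t)" .
      then have "1 / exp (3 + real k * (2 * real k)^t) \<le> 1 / (16 * B)" using B1 by (intro divide_left_mono) auto
      then show ?thesis by (simp only: exp_minus inverse_eq_divide)
    qed
    also have "\<dots> = \<kappa> / 4" by (simp add: \<kappa>_def)
    finally show ?thesis .
  qed
  have n0: "n > 0" using degn by simp
  note lm = lemniscate_lmeasurable[OF SI1 n0]
  have inner: "cmod (poly A z) * (1 - \<kappa>/4) \<le> cmod (poly p z)" if z: "cmod z \<le> 1 - h" for z
  proof -
    have "cmod z ^ N \<le> (1 - h)^N" using z by (intro power_mono) auto
    then have "cmod (poly A z) * (1 - \<kappa>/4) \<le> cmod (poly A z) * (1 - cmod z ^ N)"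
      using decay by (intro mult_left_mono) auto
    also have "\<dots> \<le> cmod (poly p z)" using z h by (intro SI2) auto
    finally show ?thesis .
  qed
  have sub: "lemniscate p \<subseteq> cbox (Complex (-2) (-11*h)) (Complex 2 (11*h)) \<union> (ball 0 (1+2*h) - ball 0 (1-h))"
  proof
    fix z assume "z \<in> lemniscate p"
    then have pz: "cmod (poly p z) < 1" and z2: "cmod z < 2" using lm(2) by (auto simp: lemniscate_def)
    show "z \<in> cbox (Complex (-2) (-11*h)) (Complex 2 (11*h)) \<union> (ball 0 (1+2*h) - ball 0 (1-h))"
    proof (cases "\<bar>Im z\<bar> \<le> 11 * h")
      case True
      have "\<bar>Re z\<bar> \<le> 2" using z2 abs_Re_le_cmod[of z] by linarith
      then show ?thesis using True by (simp add: in_cbox_complex_iff abs_le_iff)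
    next
      case False
      have "\<not> cmod z < 1 - h"
      proof
        assume z: "cmod z < 1 - h"
        \<comment> \<open>The gain \<open>\<kappa>/2\<close> of \<open>A\<close> off the strip
          outweighs the relative loss \<open>\<kappa>/4\<close> caused by the reflected
          term.\<close>
        have "1 \<le> (1 + \<kappa>/2) * (1 - \<kappa>/4)"
          using mult_left_mono[of \<kappa> "1/4" \<kappa>] \<kappa> by (simp add: algebra_simps)
        also have "\<dots> \<le> cmod (poly A z) * (1 - \<kappa>/4)"
          using Abig[of z] False z h \<kappa> by (intro mult_right_mono) auto
        also have "\<dots> \<le> cmod (poly p z)" using z by (intro inner) auto
        finally show False using pz by simp
      qed
      moreover have "cmod z < 1 + 2 * h"
      proof (rule ccontr)
        assume "\<not> cmod z < 1 + 2 * h"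
        then have zb: "1 + 2 * h \<le> cmod z" by simp
        \<comment> \<open>This puts \<open>inverse z\<close> into the inner disc, where
          \<open>p\<close> is at least 1/4; the factor \<open>cmod z ^ n\<close> in the reflection
          identity then lifts \<open>p\<close> at \<open>z\<close> to at least 1.\<close>
        have "1 \<le> (1 - h) * (1 + 2 * h)" using mult_left_mono[of h "1/12" h] h by (simp add: algebra_simps)
        also have "\<dots> \<le> (1 - h) * cmod z" using zb h by (intro mult_left_mono) auto
        finally have hz: "1 \<le> (1 - h) * cmod z" .
        have z0: "z \<noteq> 0" using zb h by auto
        define u where "u = inverse z"
        have "cmod u = 1 / cmod z" by (simp add: u_def inverse_eq_divide norm_divide)
        then have u: "cmod u \<le> 1 - h" using hz z0 by (simp add: divide_le_eq)
        have "(1/2) * (1 - \<kappa>/4) \<le> cmod (poly A u) * (1 - \<kappa>/4)"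
          using Ahalf[of u] u h \<kappa> by (intro mult_right_mono) auto
        also have "\<dots> \<le> cmod (poly p u)" by (rule inner[OF u])
        finally have pu: "1/4 \<le> cmod (poly p u)" using \<kappa> by simp
        have "(1 - h)^N * cmod z ^ n \<ge> (1 - h)^n * cmod z ^ n"
          using h NA by (intro mult_right_mono power_decreasing) auto
        moreover have "1 \<le> ((1 - h) * cmod z)^n" using hz by (rule one_le_power)
        ultimately have "1 \<le> (1 - h)^N * cmod z ^ n" by (simp add: power_mult_distrib)
        also have "\<dots> \<le> (1/4) * cmod z ^ n" using decay \<kappa> by (intro mult_right_mono) auto
        also have "\<dots> \<le> cmod (poly p u) * cmod z ^ n" using pu by (intro mult_right_mono) auto
        also have "\<dots> = cmod (poly p z)" using SI3[OF z0] by (simp add: u_def)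
        finally show False using pz by simp
      qed
      ultimately show ?thesis by simp
    qed
  qed
  have "measure lebesgue (lemniscate p) \<le> 120 * h" by (rule measure_strip_and_annulus[OF h lm(1) sub])
  then show ?thesis using SI1 by (auto simp: h_def)
qed

section \<open>Choice of parameters and the two-sided estimate\<close>

lemma twenty_squares_le_two_power: "12 \<le> k \<Longrightarrow> 20 * k^2 \<le> (2::nat)^k"
proof (induction k rule: nat_induct_at_least)
  case (Suc k)
  have "20 * (Suc k)^2 = 20 * k^2 + (40 * k + 20)" by (simp add: power2_eq_square)
  also have "40 * k + 20 \<le> 20 * k^2" 
  proof -
    have "12 * k \<le> k * k" using Suc.hyps by (rule mult_le_mono1)
    then have "40 * k + 20 \<le> 20 * (k * k)" using Suc.hyps by linarith
    then show ?thesis by (simp only: power2_eq_square)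
  qed
  finally show ?case using Suc.IH by simp
qed simp

theorem mainTheorem1:
  shows "\<exists>c C :: real. 0 < c \<and> c < C \<and>
    (\<forall>n::nat. n \<ge> 3 \<longrightarrow>
       c / ln (real n) \<le> (INF p \<in> monic_polys_zeros_in n (cball 0 1). measure lebesgue (lemniscate p)) \<and>
       (INF p \<in> monic_polys_zeros_in n (cball 0 1). measure lebesgue (lemniscate p)) \<le> C / ln (ln (real n)))"
proof -
  define c :: real where "c = pi / (2^60 * exp (2^22))"
  have "c \<le> pi / 1" unfolding c_def
    by (intro divide_left_mono) (auto intro: order_trans[OF _ mult_mono[of 1 _ 1]])
  then have c: "0 < c" "c < 240" using pi_less_4 by (auto simp: c_def)
  have "c / ln (real n) \<le> (INF p \<in> monic_polys_zeros_in n (cball 0 1). measure lebesgue (lemniscate p)) \<and>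
       (INF p \<in> monic_polys_zeros_in n (cball 0 1). measure lebesgue (lemniscate p)) \<le> 240 / ln (ln (real n))"
    if n: "n \<ge> 3" for n :: nat
  proof
    define P where "P = monic_polys_zeros_in n (cball 0 1)"
    have "monom 1 n \<in> P"
      using n by (auto simp: P_def monic_polys_zeros_in_def degree_monom_eq lead_coeff_monom poly_monom)
    then have ne: "P \<noteq> {}" by blast
    show "c / ln (real n) \<le> (INF p \<in> P. measure lebesgue (lemniscate p))"
      using lemniscate_area_lower_bound n unfolding c_def P_def
      by (intro cINF_greatest ne[unfolded P_def]) auto
    have up: "(INF p \<in> P. measure lebesgue (lemniscate p)) \<le> measure lebesgue (lemniscate p)" if "p \<in> P" for p
      using that by (intro cINF_lower bdd_belowI[of _ 0]) auto
    \<comment> \<open>Since \<open>exp 1 < 3\<close>, the iterated logarithm is already positive at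
      \<open>n = 3\<close>.\<close>
    have ln1: "ln (real n) > 1"
    proof -
      have "exp 1 < real n" using n e_less_272 by linarith
      then have "ln (exp 1) < ln (real n)" using n by (subst ln_less_cancel_iff) auto
      then show ?thesis by simp
    qed
    then have lnln: "ln (ln (real n)) > 0" by simp
    show "(INF p \<in> P. measure lebesgue (lemniscate p)) \<le> 240 / ln (ln (real n))"
    proof (cases "ln (ln (real n)) < 12")
      \<comment> \<open>The bound exceeds 20 here, so the power of degree \<open>n\<close>, whose
        lemniscate lies in a disc of area \<open>4 * pi\<close>, is good enough.\<close>
      case True
      have "lemniscate (monom 1 n) \<subseteq> ball 0 2" "lemniscate (monom 1 n) \<in> lmeasurable"
        using lemniscate_lmeasurable[of "monom 1 n" n] \<open>monom 1 n \<in> P\<close> n by (auto simp: P_def)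
      then have "measure lebesgue (lemniscate (monom 1 n)) \<le> measure lebesgue (ball (0::complex) 2)"
        by (intro measure_mono_fmeasurable) auto
      also have "\<dots> \<le> 16" using pi_less_4 by (simp add: content_disk)
      also have "\<dots> \<le> 240 / ln (ln (real n))" using True lnln by (simp add: field_simps)
      finally show ?thesis using up[OF \<open>monom 1 n \<in> P\<close>] by linarith
    next
      case False
      \<comment> \<open>The degree condition holds since
        \<open>(2*k)^(2*k) \<le> exp (4 * k^2) \<le> exp (exp k) \<le> n\<close>. Rounding down
        costs at most a factor 2, which turns 120 into 240.\<close>
      define k where "k = nat \<lfloor>ln (ln (real n))\<rfloor>"
      have k12: "k \<ge> 12" using False by (simp add: k_def le_nat_floor)
      have k: "real k \<le> ln (ln (real n))" "ln (ln (real n)) \<le> real k + 1"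
        using lnln by (auto simp: k_def)
      note pow = twenty_squares_le_two_power[OF k12]
      have "real ((2*k)^(2*k)) \<le> real n"
      proof -
        have "real ((2*k)^(2*k)) = (2 * real k) ^ (2*k)" by simp
        also have "\<dots> \<le> exp (2 * real k) ^ (2*k)"
          using exp_ge_add_one_self[of "2 * real k"] by (intro power_mono) linarith+
        also have "\<dots> = exp (4 * (real k)^2)" by (simp add: exp_of_nat_mult[symmetric] power2_eq_square)
        also have "\<dots> \<le> exp (exp (real k))"
        proof -
          have "4 * k^2 \<le> 2^k" using pow by simp
          then have "real (4 * k^2) \<le> real (2^k)" by (rule of_nat_mono)
          then have "4 * (real k)^2 \<le> 2^k" by simp
          also have "\<dots> \<le> exp 1 ^ k" using exp_ge_add_one_self[of "1::real"] by (intro power_mono) auto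
          also have "\<dots> = exp (real k)" by (simp add: exp_of_nat_mult[symmetric])
          finally show ?thesis by simp
        qed
        also have "\<dots> \<le> exp (exp (ln (ln (real n))))" using k by simp
        also have "\<dots> = real n" using ln1 n by simp
        finally show ?thesis .
      qed
      then have "(2*k)^(2*k) \<le> n" by (simp only: of_nat_le_iff)
      from small_lemniscate_exists[OF k12 pow this] obtain p
        where p: "p \<in> P" "measure lebesgue (lemniscate p) \<le> 120 / real k" by (auto simp: P_def)
      have "120 / real k = 240 / (2 * real k)" by simp
      also have "\<dots> \<le> 240 / ln (ln (real n))" using k k12 lnln by (intro divide_left_mono) auto
      finally show ?thesis using p up[OF p(1)] by linarith
    qed
  qed
  then show ?thesis using c by blast
qed

end
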